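(* Let $\mathfrak{A}$ be a separable unital $C^*$-algebra, let $K\subset\mathfrak{A}$ be a compact set generating $\mathfrak{A}$, and let $a,b\in\mathfrak{A}$, $\lambda\in\mathbb{C}$. Then: (1) $\omega^K_{a+\lambda 1}=\omega^K_a=\omega^K_{a^*}$; (2) $\omega^K_a=0$ if and only if $a\in\mathbb{C}1$; (3) $\omega^K_{\lambda a}=|\lambda|\,\omega^K_a$; (4) $\omega^K_{a+b}\le\omega^K_a+\omega^K_b$; (5) $\omega^K_{ab}\le\|a\|\,\omega^K_b+\|b\|\,\omega^K_a$. (Inequalities between functions are pointwise.)
   Context: A set $K\subset\mathfrak{A}$ generates the unital $C^*$-algebra $\mathfrak{A}$ if the smallest $C^*$-subalgebra of $\mathfrak{A}$ containing $K\cup\{1\}$ is $\mathfrak{A}$. $\operatorname{Rep}(\mathfrak{A})$ denotes the set of all unital $*$-representations $\pi:\mathfrak{A}\to B(\ell^2)$, with the metric $d_K(\pi,\pi')=\sup_{x\in K}\|\pi(x)-\pi'(x)\|$. $\Omega$ is the set of all continuous, concave, nondecreasing functions $\omega:[0,\infty)\to[0,\infty)$ with $\omega(0)=0$ (concavity in the weak sense, so $0\in\Omega$). For $a\in\mathfrak{A}$ and $t\ge 0$ put $f^K_a(t)=\sup\{\|\pi(a)-\pi'(a)\|:\pi,\pi'\in\operatorname{Rep}(\mathfrak{A}),\ d_K(\pi,\pi')\le t\}$ and $\omega^K_a(t)=\inf\{\omega(t):\omega\in\Omega,\ \omega\ge f^K_a\}$; the set over which the infimum is taken is nonempty. *)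

theory Defs
  imports "HOL-Analysis.Analysis"
begin

section \<open>Complex normed spaces and unital C*-algebras\<close>

class complex_vector = real_vector +
  fixes scaleC :: "complex \<Rightarrow> 'a \<Rightarrow> 'a" (infixr "*\<^sub>C" 75)
  assumes scaleC_add_right: "c *\<^sub>C (x + y) = c *\<^sub>C x + c *\<^sub>C y"
    and scaleC_add_left: "(c + d) *\<^sub>C x = c *\<^sub>C x + d *\<^sub>C x"
    and scaleC_scaleC: "c *\<^sub>C d *\<^sub>C x = (c * d) *\<^sub>C x"
    and scaleR_scaleC: "r *\<^sub>R x = complex_of_real r *\<^sub>C x"

class complex_normed_vector = complex_vector + real_normed_vector +
  assumes norm_scaleC: "norm (c *\<^sub>C x) = cmod c * norm x"

text \<open>As usual for unital Banach algebras, \<open>real_normed_algebra_1\<close> includes \<open>0 \<noteq> 1\<close>.\<close>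

class unital_cstar_algebra = complex_normed_vector + real_normed_algebra_1 + banach +
  fixes adj :: "'a \<Rightarrow> 'a"
  assumes mult_scaleC_left: "(c *\<^sub>C x) * y = c *\<^sub>C (x * y)"
    and mult_scaleC_right: "x * (c *\<^sub>C y) = c *\<^sub>C (x * y)"
    and adj_add: "adj (x + y) = adj x + adj y"
    and adj_scaleC: "adj (c *\<^sub>C x) = cnj c *\<^sub>C adj x"
    and adj_mult: "adj (x * y) = adj y * adj x"
    and adj_adj: "adj (adj x) = x"
    and cstar_identity: "norm (adj x * x) = (norm x)\<^sup>2"

definition cstar_subalgebra :: "'a::unital_cstar_algebra set \<Rightarrow> bool" where
  "cstar_subalgebra B \<longleftrightarrow> closed B \<and> 0 \<in> B \<and>
     (\<forall>x\<in>B. \<forall>y\<in>B. x + y \<in> B \<and> x * y \<in> B) \<and>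
     (\<forall>x\<in>B. adj x \<in> B \<and> (\<forall>c. c *\<^sub>C x \<in> B))"

definition cstar_generated :: "'a::unital_cstar_algebra set \<Rightarrow> 'a set" where
  "cstar_generated S = \<Inter>{B. cstar_subalgebra B \<and> S \<subseteq> B}"

definition generates :: "'a::unital_cstar_algebra set \<Rightarrow> bool" where
  "generates K \<longleftrightarrow> cstar_generated (K \<union> {1}) = UNIV"

section \<open>The Hilbert space of square-summable sequences\<close>

lemma square_summable_add_scale:
  fixes f g :: "nat \<Rightarrow> complex"
  assumes "summable (\<lambda>n. (cmod (f n))\<^sup>2)" "summable (\<lambda>n. (cmod (g n))\<^sup>2)"
  shows "summable (\<lambda>n. (cmod (c * f n + d * g n))\<^sup>2)"
proof (rule summable_comparison_test')
  show "summable (\<lambda>n. 2 * (cmod c)\<^sup>2 * (cmod (f n))\<^sup>2 + 2 * (cmod d)\<^sup>2 * (cmod (g n))\<^sup>2)"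
    by (intro summable_add summable_mult assms)
  fix n :: nat
  have "(cmod (c * f n + d * g n))\<^sup>2 \<le> (cmod (c * f n) + cmod (d * g n))\<^sup>2"
    by (intro power_mono norm_triangle_ineq) simp
  also have "\<dots> \<le> 2 * (cmod (c * f n))\<^sup>2 + 2 * (cmod (d * g n))\<^sup>2"
    using sum_squares_bound[of "cmod (c * f n)" "cmod (d * g n)"]
    by (simp add: power2_sum)
  finally show "norm ((cmod (c * f n + d * g n))\<^sup>2)
      \<le> 2 * (cmod c)\<^sup>2 * (cmod (f n))\<^sup>2 + 2 * (cmod d)\<^sup>2 * (cmod (g n))\<^sup>2"
    by (simp add: norm_mult power_mult_distrib mult.assoc)
qed

typedef ell2 = "{f :: nat \<Rightarrow> complex. summable (\<lambda>n. (cmod (f n))\<^sup>2)}"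
  morphisms ell2_nth Abs_ell2
  by (rule exI[of _ "\<lambda>_. 0"]) simp

setup_lifting type_definition_ell2

lemma summable_ell2: "summable (\<lambda>n. (cmod (ell2_nth x n))\<^sup>2)"
  using ell2_nth[of x] by simp

instantiation ell2 :: complex_vector
begin

lift_definition zero_ell2 :: ell2 is "\<lambda>_. 0" by simp

lift_definition plus_ell2 :: "ell2 \<Rightarrow> ell2 \<Rightarrow> ell2" is "\<lambda>f g n. f n + g n"
  using square_summable_add_scale[of _ _ 1 1] by simp

lift_definition minus_ell2 :: "ell2 \<Rightarrow> ell2 \<Rightarrow> ell2" is "\<lambda>f g n. f n - g n"
  using square_summable_add_scale[of _ _ 1 "-1"] by simp

lift_definition uminus_ell2 :: "ell2 \<Rightarrow> ell2" is "\<lambda>f n. - f n"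
  by simp

lift_definition scaleC_ell2 :: "complex \<Rightarrow> ell2 \<Rightarrow> ell2" is "\<lambda>c f n. c * f n"
  using square_summable_add_scale[of _ _ _ 0] by simp

definition scaleR_ell2 :: "real \<Rightarrow> ell2 \<Rightarrow> ell2" where
  "scaleR_ell2 r x = complex_of_real r *\<^sub>C x"

instance
  by standard (unfold scaleR_ell2_def, (transfer, simp add: fun_eq_iff algebra_simps)+)

end

definition ell2_inner :: "ell2 \<Rightarrow> ell2 \<Rightarrow> complex" where
  "ell2_inner x y = (\<Sum>n. ell2_nth x n * cnj (ell2_nth y n))"

instantiation ell2 :: complex_normed_vector
begin

definition norm_ell2 :: "ell2 \<Rightarrow> real" where
  "norm_ell2 x = sqrt (\<Sum>n. (cmod (ell2_nth x n))\<^sup>2)"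

definition sgn_ell2 :: "ell2 \<Rightarrow> ell2" where
  "sgn_ell2 x = x /\<^sub>R norm x"

definition dist_ell2 :: "ell2 \<Rightarrow> ell2 \<Rightarrow> real" where
  "dist_ell2 x y = norm (x - y)"

definition uniformity_ell2 :: "(ell2 \<times> ell2) filter" where
  "uniformity_ell2 = (INF e\<in>{0 <..}. principal {(x, y). dist x y < e})"

definition open_ell2 :: "ell2 set \<Rightarrow> bool" where
  "open_ell2 U \<longleftrightarrow> (\<forall>x\<in>U. eventually (\<lambda>(x', y). x' = x \<longrightarrow> y \<in> U) uniformity)"

instance
proof
  fix x y :: ell2 and c :: complex and r :: real and U :: "ell2 set"
  show "dist x y = norm (x - y)" by (rule dist_ell2_def)
  show "sgn x = x /\<^sub>R norm x" by (rule sgn_ell2_def)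
  show "uniformity = (INF e\<in>{0 <..}. principal {(x::ell2, y). dist x y < e})"
    by (rule uniformity_ell2_def)
  show "open U \<longleftrightarrow> (\<forall>x\<in>U. eventually (\<lambda>(x', y). x' = x \<longrightarrow> y \<in> U) uniformity)"
    by (rule open_ell2_def)
  have "norm x = 0 \<longleftrightarrow> (\<forall>n. ell2_nth x n = 0)"
    using suminf_eq_zero_iff[OF summable_ell2[of x]] by (simp add: norm_ell2_def)
  also have "\<dots> \<longleftrightarrow> x = 0"
    by transfer (simp add: fun_eq_iff)
  finally show "norm x = 0 \<longleftrightarrow> x = 0" .
  show scC: "norm (c *\<^sub>C x) = cmod c * norm x" for c and x :: ell2
    by (simp add: norm_ell2_def scaleC_ell2.rep_eq norm_mult power_mult_distrib
        suminf_mult[OF summable_ell2] real_sqrt_mult)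
  show "norm (r *\<^sub>R x) = \<bar>r\<bar> * norm x"
    by (simp add: scaleR_ell2_def scC)
  have lim: "(\<lambda>n. L2_set (\<lambda>i. cmod (ell2_nth z i)) {..<n}) \<longlonglongrightarrow> norm z" for z
    unfolding L2_set_def norm_ell2_def
    by (intro tendsto_real_sqrt summable_LIMSEQ summable_ell2)
  show "norm (x + y) \<le> norm x + norm y"
  proof (rule LIMSEQ_le[OF lim tendsto_add[OF lim lim]], intro exI allI impI)
    fix n
    have "L2_set (\<lambda>i. cmod (ell2_nth (x + y) i)) {..<n}
        \<le> L2_set (\<lambda>i. cmod (ell2_nth x i) + cmod (ell2_nth y i)) {..<n}"
      by (rule L2_set_mono) (auto simp: plus_ell2.rep_eq norm_triangle_ineq)
    also have "\<dots> \<le> L2_set (\<lambda>i. cmod (ell2_nth x i)) {..<n} + L2_set (\<lambda>i. cmod (ell2_nth y i)) {..<n}"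
      by (rule L2_set_triangle_ineq)
    finally show "L2_set (\<lambda>i. cmod (ell2_nth (x + y) i)) {..<n}
        \<le> L2_set (\<lambda>i. cmod (ell2_nth x i)) {..<n} + L2_set (\<lambda>i. cmod (ell2_nth y i)) {..<n}" .
  qed
qed

end

section \<open>Representations\<close>

text \<open>The type \<^typ>\<open>ell2 \<Rightarrow>\<^sub>L ell2\<close> consists of the bounded \<^emph>\<open>real\<close>-linear operators, with the
  operator norm; \<open>bounded_ops\<close> is the subspace of complex-linear ones, i.e. \<open>B(\<ell>\<^sup>2)\<close>.\<close>

definition bounded_ops :: "(ell2 \<Rightarrow>\<^sub>L ell2) set" where
  "bounded_ops = {T. \<forall>c x. blinfun_apply T (c *\<^sub>C x) = c *\<^sub>C blinfun_apply T x}"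

definition is_adjoint :: "(ell2 \<Rightarrow>\<^sub>L ell2) \<Rightarrow> (ell2 \<Rightarrow>\<^sub>L ell2) \<Rightarrow> bool" where
  "is_adjoint S T \<longleftrightarrow>
     (\<forall>x y. ell2_inner (blinfun_apply S x) y = ell2_inner x (blinfun_apply T y))"

text \<open>Complex homogeneity of \<open>\<pi>\<close> is expressed on vectors, since \<^typ>\<open>ell2 \<Rightarrow>\<^sub>L ell2\<close> carries only
  the real scalar multiplication.\<close>

definition Rep :: "('a::unital_cstar_algebra \<Rightarrow> ell2 \<Rightarrow>\<^sub>L ell2) set" where
  "Rep = {\<pi>. (\<forall>a. \<pi> a \<in> bounded_ops) \<and>
     (\<forall>a b. \<pi> (a + b) = \<pi> a + \<pi> b) \<and>
     (\<forall>c a x. blinfun_apply (\<pi> (c *\<^sub>C a)) x = c *\<^sub>C blinfun_apply (\<pi> a) x) \<and>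
     (\<forall>a b. \<pi> (a * b) = \<pi> a o\<^sub>L \<pi> b) \<and>
     (\<forall>a. is_adjoint (\<pi> (adj a)) (\<pi> a)) \<and>
     \<pi> 1 = id_blinfun}"

section \<open>The modulus of continuity\<close>

text \<open>Suprema are taken in \<open>[0,\<infinity>)\<close>, so the supremum of the empty set is \<open>0\<close>; this matters for
  \<open>K = {}\<close>, which is compact and generates \<open>\<complex>\<close>. Inserting \<open>0\<close> implements this convention and is
  harmless for nonempty sets of norms.\<close>

definition rep_dist :: "'a::unital_cstar_algebra set \<Rightarrow>
    ('a \<Rightarrow> ell2 \<Rightarrow>\<^sub>L ell2) \<Rightarrow> ('a \<Rightarrow> ell2 \<Rightarrow>\<^sub>L ell2) \<Rightarrow> real" where
  "rep_dist K \<pi> \<pi>' = Sup (insert 0 {norm (\<pi> x - \<pi>' x) | x. x \<in> K})"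

definition osc :: "'a::unital_cstar_algebra set \<Rightarrow> 'a \<Rightarrow> real \<Rightarrow> real" where
  "osc K a t = Sup (insert 0 {norm (\<pi> a - \<pi>' a) | \<pi> \<pi>'. \<pi> \<in> Rep \<and> \<pi>' \<in> Rep \<and> rep_dist K \<pi> \<pi>' \<le> t})"

text \<open>Functions on \<open>[0,\<infinity>)\<close> are represented by functions on \<^typ>\<open>real\<close>, whose values at negative
  arguments are irrelevant.\<close>

definition Moduli :: "(real \<Rightarrow> real) set" where
  "Moduli = {w. continuous_on {0..} w \<and> concave_on {0..} w \<and> mono_on {0..} w \<and>
     (\<forall>t\<ge>0. 0 \<le> w t) \<and> w 0 = 0}"

definition modulus :: "'a::unital_cstar_algebra set \<Rightarrow> 'a \<Rightarrow> real \<Rightarrow> real" where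
  "modulus K a t = Inf {w t | w. w \<in> Moduli \<and> (\<forall>s\<ge>0. osc K a s \<le> w s)}"

end

theory Submission
  imports Defs
begin

text \<open>The parts on shifts, multiples, sums and products are formal. If the variation
  \<open>norm (\<pi> c - \<pi>' c)\<close> over each pair of representations is bounded by a nonnegative combination of the
  variations of \<open>a\<close> and \<open>b\<close>, then the modulus of \<open>c\<close> is bounded by the same combination of the moduli
  (\<open>modulus_combination\<close>). Such bounds follow from linearity, from the equality of norms of an
  operator and its adjoint, and, for products, from contractivity of representations (\<open>Rep_norm_le\<close>). This needs that
  each oscillation has a majorant among the moduli: the elements having one form a C*-subalgebra that
  contains the generating set (\<open>majorants_nonempty\<close>).

  The depth lies in the implication from a vanishing modulus to scalar elements. If the modulus of \<open>a\<close>
  vanishes, all representations agree at \<open>a\<close>. Since representations can be conjugated by unitaries,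
  they send \<open>a\<close> to a common scalar \<open>c\<close>, and \<open>a = c 1\<close> as soon as representations on \<open>\<ell>\<^sup>2\<close> separate points
  (\<open>scalar_if_Rep_agree\<close>, \<open>Rep_separates_points\<close>).

  Separation of points is the theorem of Gelfand and Naimark for a separable algebra, proved here
  without spectra. Positive elements are defined by a norm inequality and have square roots that
  commute with everything the element commutes with; from this it follows that \<open>adj x * x\<close> is positive
  (\<open>pos_adj_mult_self\<close>). A Hahn-Banach argument then yields a positive functional that does not vanish
  at \<open>adj b * b\<close> for a given \<open>b \<noteq> 0\<close> (\<open>exists_positive_functional\<close>). Orthonormalising a dense sequence for
  the form \<open>\<phi> (adj y * x)\<close> turns \<open>\<phi>\<close> into a family of infinite matrices, and such a family defines a
  representation on \<open>\<ell>\<^sup>2\<close> (locale \<open>star_matrix\<close>); no completion is needed.\<close>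

section \<open>Semi-inner products\<close>

lemma scaleC_one [simp]: "1 *\<^sub>C x = (x::'a::complex_vector)"
  using scaleR_scaleC[of 1 x] by simp

lemma scaleC_zero_left [simp]: "0 *\<^sub>C x = (0::'a::complex_vector)"
  using scaleR_scaleC[of 0 x] by simp

lemma scaleC_zero_right [simp]: "c *\<^sub>C 0 = (0::'a::complex_vector)"
  using scaleC_add_right[of c 0 0] by simp

lemma scaleC_minus_left [simp]: "(- c) *\<^sub>C x = - (c *\<^sub>C (x::'a::complex_vector))"
  using scaleC_add_left[of c "-c" x] by (simp add: eq_neg_iff_add_eq_0 add.commute)

lemma scaleC_minus_right [simp]: "c *\<^sub>C (- x) = - (c *\<^sub>C (x::'a::complex_vector))"
  using scaleC_add_right[of c x "-x"] by (simp add: eq_neg_iff_add_eq_0 add.commute)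

lemma scaleC_diff_right: "c *\<^sub>C (x - y) = c *\<^sub>C x - c *\<^sub>C (y::'a::complex_vector)"
  using scaleC_add_right[of c x "-y"] by simp

lemma scaleC_diff_left: "(c - d) *\<^sub>C x = c *\<^sub>C x - d *\<^sub>C (x::'a::complex_vector)"
  using scaleC_add_left[of c "-d" x] by simp

text \<open>The form may be degenerate: it is used both for \<open>ell2_inner\<close> and for the forms
  \<open>\<phi> (adj y * x)\<close> on the algebra, so that no quotient by the null vectors is ever formed.\<close>

locale semi_inner =
  fixes g :: "'v::complex_vector \<Rightarrow> 'v \<Rightarrow> complex"
  assumes add_left: "g (x + y) z = g x z + g y z"
    and scale_left: "g (c *\<^sub>C x) z = c * g x z"
    and herm: "g y x = cnj (g x y)"
    and nonneg: "0 \<le> Re (g x x)"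
begin

lemma add_right: "g z (x + y) = g z x + g z y"
  using add_left[of x y z] by (metis complex_cnj_add herm)

lemma scale_right: "g z (c *\<^sub>C x) = cnj c * g z x"
  using scale_left[of c x z] by (metis complex_cnj_mult herm)

lemma zero_left [simp]: "g 0 z = 0"
  using scale_left[of 0 0 z] by simp

lemma zero_right [simp]: "g z 0 = 0"
  using scale_right[of z 0 0] by simp

lemma minus_left [simp]: "g (- x) z = - g x z"
  using scale_left[of "-1" x z] by simp

lemma minus_right [simp]: "g z (- x) = - g z x"
  using scale_right[of z "-1" x] by simp

lemma diff_left: "g (x - y) z = g x z - g y z"
  using add_left[of x "-y" z] by simp

lemma diff_right: "g z (x - y) = g z x - g z y"
  using add_right[of z x "-y"] by simp

lemma sum_left: "g (sum f A) z = (\<Sum>i\<in>A. g (f i) z)"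
  by (induction A rule: infinite_finite_induct) (auto simp: add_left)

lemma sum_right: "g z (sum f A) = (\<Sum>i\<in>A. g z (f i))"
  by (induction A rule: infinite_finite_induct) (auto simp: add_right)

lemma self_real: "g x x = of_real (Re (g x x))"
  using herm[of x x] by (simp add: complex_eq_iff)

definition seminorm :: "'v \<Rightarrow> real" where "seminorm x = sqrt (Re (g x x))"

lemma seminorm_nonneg [simp]: "0 \<le> seminorm x"
  by (simp add: seminorm_def nonneg)

lemma seminorm_square: "(seminorm x)\<^sup>2 = Re (g x x)"
  by (simp add: seminorm_def nonneg)

lemma self_sn: "g x x = of_real ((seminorm x)\<^sup>2)"
  using self_real seminorm_square by metis

text \<open>Expanding the square of \<open>x - t * g x y * y\<close> for real \<open>t\<close> leaves a family of inequalities. A null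
  vector \<open>y\<close> is covered as well: the quadratic term is then absent, and a large \<open>t\<close> forces
  \<open>g x y = 0\<close>.\<close>

lemma Cauchy_Schwarz: "cmod (g x y) \<le> seminorm x * seminorm y"
proof -
  let ?c = "g x y"
  have expand: "2 * t * (cmod ?c)\<^sup>2 \<le> (seminorm x)\<^sup>2 + t\<^sup>2 * (cmod ?c)\<^sup>2 * (seminorm y)\<^sup>2" for t :: real
  proof -
    let ?z = "x - (of_real t * ?c) *\<^sub>C y"
    have "g ?z ?z = g x x - of_real t * (cnj ?c * ?c) - of_real t * (?c * g y x)
        + of_real t * of_real t * (?c * cnj ?c) * g y y"
      by (simp add: diff_left diff_right scale_left scale_right algebra_simps)
    also have "\<dots> = of_real ((seminorm x)\<^sup>2 - 2 * t * (cmod ?c)\<^sup>2 + t\<^sup>2 * (cmod ?c)\<^sup>2 * (seminorm y)\<^sup>2)"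
      unfolding herm[of y x] self_sn
      by (simp add: mult.commute[of "cnj ?c"] complex_norm_square[symmetric] power2_eq_square)
    finally show ?thesis using nonneg[of ?z] by simp
  qed
  have "(cmod ?c)\<^sup>2 \<le> (seminorm x * seminorm y)\<^sup>2"
  proof (cases "seminorm y = 0")
    case False
    \<comment> \<open>the minimising choice is \<open>t = 1 / v\<close>\<close>
    define v where "v = (seminorm y)\<^sup>2"
    have v: "v > 0" using False by (simp add: v_def)
    then have "(1 / v)\<^sup>2 * (cmod ?c)\<^sup>2 * v = (cmod ?c)\<^sup>2 / v" by (simp add: power2_eq_square)
    then have "(cmod ?c)\<^sup>2 / v \<le> (seminorm x)\<^sup>2" using expand[of "1 / v"] unfolding v_def by simp
    with v show ?thesis by (simp add: v_def field_simps)
  next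
    case True
    have "cmod ?c = 0"
    proof (rule ccontr)
      assume "cmod ?c \<noteq> 0"
      then show False using expand[of "((seminorm x)\<^sup>2 + 1) / (cmod ?c)\<^sup>2"] True
        by simp (smt (verit) zero_le_power2)
    qed
    then show ?thesis by simp
  qed
  then show ?thesis by (rule power2_le_imp_le) simp
qed

lemma seminorm_triangle: "seminorm (x + y) \<le> seminorm x + seminorm y"
proof -
  have "Re (g x y) \<le> seminorm x * seminorm y" "Re (g y x) \<le> seminorm y * seminorm x"
    using Cauchy_Schwarz complex_Re_le_cmod order_trans by blast+
  then have "(seminorm (x + y))\<^sup>2 \<le> (seminorm x + seminorm y)\<^sup>2"
    by (simp add: seminorm_square add_left add_right power2_sum algebra_simps)
  then show ?thesis by (rule power2_le_imp_le) simp
qed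

end

section \<open>Positive elements\<close>

lemma norm_adj [simp]: "norm (adj x) = norm (x::'a::unital_cstar_algebra)"
proof -
  have le: "norm y \<le> norm (adj y)" for y :: 'a
  proof (cases "y = 0")
    case False
    have "norm y * norm y \<le> norm (adj y) * norm y"
      using norm_mult_ineq[of "adj y" y] cstar_identity[of y] by (simp add: power2_eq_square)
    with False show ?thesis by simp
  qed simp
  show ?thesis using le[of x] le[of "adj x"] by (simp add: adj_adj)
qed

lemma adj_zero [simp]: "adj 0 = (0::'a::unital_cstar_algebra)"
  using adj_add[of 0 "0::'a"] by simp

lemma adj_minus [simp]: "adj (- x) = - adj (x::'a::unital_cstar_algebra)"
  using adj_add[of x "-x"] by (simp add: eq_neg_iff_add_eq_0 add.commute)

lemma adj_diff: "adj (x - y) = adj x - adj (y::'a::unital_cstar_algebra)"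
  using adj_add[of x "-y"] by simp

lemma adj_one [simp]: "adj 1 = (1::'a::unital_cstar_algebra)"
  using adj_mult[of "adj 1" "1::'a"] by (simp add: adj_adj)

lemma adj_scaleR: "adj (r *\<^sub>R x) = r *\<^sub>R adj (x::'a::unital_cstar_algebra)"
  by (simp add: scaleR_scaleC adj_scaleC)

lemma bounded_linear_adj: "bounded_linear (adj :: 'a \<Rightarrow> 'a::unital_cstar_algebra)"
  by (rule bounded_linear_intro[where K = 1]) (auto simp: adj_add adj_scaleR)

lemma norm_sa_square:
  "adj h = h \<Longrightarrow> norm (h * h) = (norm (h::'a::unital_cstar_algebra))\<^sup>2"
  using cstar_identity[of h] by simp

lemma sa_nilpotent:
  assumes "adj h = h" "h * h * h = 0" shows "h = (0::'a::unital_cstar_algebra)"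
proof -
  have "norm (h * h * (h * h)) = (norm (h * h))\<^sup>2"
    by (rule norm_sa_square) (simp add: adj_mult assms)
  moreover have "h * h * (h * h) = 0" using assms(2) by (metis mult.assoc mult_zero_left)
  ultimately show ?thesis using norm_sa_square[OF assms(1)] by simp
qed

text \<open>The element \<open>u = h + \<i> k\<close> has real part \<open>h\<close> and satisfies \<open>adj u * u = h\<^sup>2 + k\<^sup>2\<close>, so the
  C*-identity turns the trivial bound for a real part into this one. It does the work of the
  spectral radius formula below.\<close>

lemma norm_le_sum_squares:
  fixes h k :: "'a::unital_cstar_algebra"
  assumes "adj h = h" "adj k = k" "h * k = k * h"
  shows "(norm h)\<^sup>2 \<le> norm (h * h + k * k)"
proof -
  define u where "u = h + \<i> *\<^sub>C k"
  have au: "adj u = h - \<i> *\<^sub>C k" by (simp add: u_def adj_add adj_scaleC assms)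
  have "\<i> *\<^sub>C \<i> *\<^sub>C k = - k" for k :: 'a by (simp add: scaleC_scaleC)
  then have "adj u * u = h * h + k * k"
    unfolding au by (simp add: u_def algebra_simps mult_scaleC_left mult_scaleC_right scaleC_diff_right assms)
  then have nu: "(norm u)\<^sup>2 = norm (h * h + k * k)" by (metis cstar_identity)
  have "2 *\<^sub>R h = u + adj u" by (simp only: au) (simp add: u_def scaleR_2)
  then have "2 * norm h \<le> norm u + norm (adj u)"
    by (metis norm_triangle_ineq norm_scaleR abs_numeral)
  then have "norm h \<le> norm u" by simp
  then show ?thesis unfolding nu[symmetric] by (simp add: power_mono)
qed

text \<open>The square root of \<open>1 - q\<close> is \<open>1 - y\<close>, where \<open>y\<close> solves \<open>y = (q + y\<^sup>2) / 2\<close>. Iterating this equation from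
  \<open>0\<close> gives polynomials in \<open>q\<close> with nonnegative coefficients, so the increments are bounded in norm
  by those of the scalar iteration for \<open>q = 1\<close>, which is increasing and bounded by \<open>1\<close>. This
  comparison covers \<open>norm q = 1\<close>, where the iteration is no contraction. That the root commutes with
  whatever commutes with \<open>q\<close> replaces the functional calculus.\<close>

lemma sqrt_one_minus:
  fixes q :: "'a::unital_cstar_algebra"
  assumes "adj q = q" "norm q \<le> 1"
  shows "\<exists>y. adj y = y \<and> norm y \<le> 1 \<and> (1 - y) * (1 - y) = 1 - q \<and>
    (\<forall>c. c * q = q * c \<longrightarrow> c * y = y * c)"
proof -
  \<comment> \<open>the iteration in the algebra and its scalar majorant, the case \<open>q = 1\<close>\<close>
  define Y where "Y = rec_nat (0::'a) (\<lambda>_ y. (1/2) *\<^sub>R (q + y * y))"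
  define S where "S = rec_nat (0::real) (\<lambda>_ s. (1 + s * s) / 2)"
  have Y0 [simp]: "Y 0 = 0" and YS: "Y (Suc n) = (1/2) *\<^sub>R (q + Y n * Y n)" for n
    by (simp_all add: Y_def)
  have S0 [simp]: "S 0 = 0" and SS: "S (Suc n) = (1 + S n * S n) / 2" for n
    by (simp_all add: S_def)
  have S: "0 \<le> S n \<and> S n \<le> 1" for n
    by (induction n) (auto simp: SS mult_le_one)
  have NY: "norm (Y n) \<le> S n" for n
  proof (induction n)
    case (Suc n)
    have "norm (Y n * Y n) \<le> S n * S n"
      by (rule order_trans[OF norm_mult_ineq]) (intro mult_mono Suc norm_ge_zero, use S in auto)
    then have "norm (q + Y n * Y n) \<le> 1 + S n * S n"
      using norm_triangle_ineq[of q "Y n * Y n"] assms(2) by linarith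
    then show ?case by (simp add: YS SS)
  qed simp
  have ND: "norm (Y (Suc n) - Y n) \<le> S (Suc n) - S n" for n
  proof (induction n)
    case 0
    show ?case using assms(2) by (simp add: YS SS)
  next
    case (Suc n)
    let ?a = "Y (Suc n)" and ?b = "Y n" and ?s = "S (Suc n)" and ?t = "S n"
    have "?a * ?a - ?b * ?b = ?a * (?a - ?b) + (?a - ?b) * ?b" by (simp add: algebra_simps)
    then have "norm (?a * ?a - ?b * ?b) \<le> norm ?a * norm (?a - ?b) + norm (?a - ?b) * norm ?b"
      by (metis norm_triangle_le add_mono norm_mult_ineq)
    also have "\<dots> \<le> ?s * (?s - ?t) + (?s - ?t) * ?t"
      by (intro add_mono mult_mono NY Suc norm_ge_zero) (use S order_trans[OF norm_ge_zero Suc] in auto)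
    finally have "norm (?a * ?a - ?b * ?b) / 2 \<le> (?s * ?s - ?t * ?t) / 2" by (simp add: algebra_simps)
    moreover have "Y (Suc (Suc n)) - Y (Suc n) = (1/2) *\<^sub>R (?a * ?a - ?b * ?b)"
      unfolding YS[of "Suc n"] by (subst (3) YS) (simp add: algebra_simps)
    moreover have "S (Suc (Suc n)) - S (Suc n) = (?s * ?s - ?t * ?t) / 2"
      unfolding SS[of "Suc n"] by (subst (3) SS) (simp add: field_simps)
    ultimately show ?case by simp
  qed
  have "incseq S" by (rule incseq_SucI) (use ND order_trans[OF norm_ge_zero] in fastforce)
  then have "convergent S" using S by (metis incseq_convergent convergentI)
  then have "summable (\<lambda>n. S (Suc n) - S n)"
    using telescope_summable convergent_LIMSEQ_iff by blast
  then have "summable (\<lambda>n. norm (Y (Suc n) - Y n))"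
    by (rule summable_comparison_test[rotated]) (use ND in auto)
  then have "summable (\<lambda>n. Y (Suc n) - Y n)" by (rule summable_norm_cancel)
  then have "convergent (\<lambda>n. \<Sum>i<n. Y (Suc i) - Y i)" by (simp add: summable_iff_convergent)
  then have "convergent Y" by (simp add: sum_lessThan_telescope)
  then obtain y where y: "Y \<longlonglongrightarrow> y" by (auto simp: convergent_def)
  have "(\<lambda>n. (1/2) *\<^sub>R (q + Y n * Y n)) \<longlonglongrightarrow> (1/2) *\<^sub>R (q + y * y)" by (intro tendsto_intros y)
  moreover have "(\<lambda>n. (1/2) *\<^sub>R (q + Y n * Y n)) \<longlonglongrightarrow> y" using LIMSEQ_Suc[OF y] by (simp add: YS)
  ultimately have fixp: "(1/2) *\<^sub>R (q + y * y) = y" by (rule LIMSEQ_unique)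
  have "q + y * y = 2 *\<^sub>R ((1/2) *\<^sub>R (q + y * y))" by simp
  also have "\<dots> = 2 *\<^sub>R y" by (simp only: fixp)
  finally have "q + y * y = 2 *\<^sub>R y" .
  then have sq: "(1 - y) * (1 - y) = 1 - q" by (simp add: algebra_simps scaleR_2 eq_diff_eq)
  have aY: "adj (Y n) = Y n" for n
    by (induction n) (simp_all add: YS adj_scaleR adj_add adj_mult assms)
  have "(\<lambda>n. adj (Y n)) \<longlonglongrightarrow> adj y" by (rule bounded_linear.tendsto[OF bounded_linear_adj y])
  then have ay: "adj y = y" using LIMSEQ_unique y by (simp add: aY)
  have ny: "norm y \<le> 1"
    by (rule LIMSEQ_le_const2[OF tendsto_norm[OF y]]) (use NY S order_trans in blast)
  have "c * y = y * c" if c: "c * q = q * c" for c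
  proof -
    have cY: "c * Y n = Y n * c" for n
    proof (induction n)
      case (Suc n)
      have "c * (Y n * Y n) = Y n * Y n * c" by (metis Suc mult.assoc)
      then show ?case by (simp add: YS c distrib_left distrib_right)
    qed simp
    have "(\<lambda>n. c * Y n) \<longlonglongrightarrow> c * y" "(\<lambda>n. Y n * c) \<longlonglongrightarrow> y * c" by (intro tendsto_intros y)+
    then show ?thesis using LIMSEQ_unique by (simp add: cY)
  qed
  with ay ny sq show ?thesis by blast
qed

text \<open>Over the reals \<open>\<bar>t - h\<bar> \<le> t\<close> for some \<open>t \<ge> 0\<close> just says \<open>h \<ge> 0\<close>. In this form sums of positive elements
  are positive by the triangle inequality; that positive elements are the squares of self-adjoint
  ones is the content of \<open>pos_sqrt\<close> and \<open>pos_square\<close>.\<close>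

definition pos :: "'a::unital_cstar_algebra \<Rightarrow> bool" where
  "pos h \<longleftrightarrow> adj h = h \<and> (\<exists>t\<ge>0. norm (t *\<^sub>R 1 - h) \<le> t)"

lemma pos_sa: "pos h \<Longrightarrow> adj h = h" by (simp add: pos_def)

lemma pos_sqrt:
  assumes "pos (h::'a::unital_cstar_algebra)"
  obtains k where "pos k" "k * k = h" "\<And>c. c * h = h * c \<Longrightarrow> c * k = k * c"
proof -
  obtain t where t: "t \<ge> 0" "norm (t *\<^sub>R 1 - h) \<le> t" and h: "adj h = h"
    using assms by (auto simp: pos_def)
  show thesis
  proof (cases "t = 0")
    case True
    with t show thesis using that[of 0] assms by simp
  next
    case False
    with t have t0: "t > 0" by simp
    define q where "q = 1 - (1/t) *\<^sub>R h"
    have "q = (1/t) *\<^sub>R (t *\<^sub>R 1 - h)" using t0 by (simp add: q_def scaleR_diff_right)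
    then have "norm q = norm (t *\<^sub>R 1 - h) / t" using t0 by simp
    then have "norm q \<le> 1" using t0 t(2) by simp
    moreover have "adj q = q" by (simp add: q_def adj_diff adj_scaleR h)
    ultimately obtain y where y: "adj y = y" "norm y \<le> 1" "(1 - y) * (1 - y) = 1 - q"
      "\<And>c. c * q = q * c \<Longrightarrow> c * y = y * c" using sqrt_one_minus[of q] by blast
    define k where "k = sqrt t *\<^sub>R (1 - y)"
    show thesis
    proof (rule that[of k])
      have "sqrt t *\<^sub>R 1 - k = sqrt t *\<^sub>R y" by (simp add: k_def algebra_simps)
      moreover have "norm (sqrt t *\<^sub>R y) \<le> sqrt t" using t0 y(2) by (simp add: mult_left_le)
      ultimately show "pos k" unfolding pos_def
        using t0 by (auto simp: k_def adj_scaleR adj_diff y intro!: exI[of _ "sqrt t"])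
      have "k * k = t *\<^sub>R ((1 - y) * (1 - y))" using t0 by (simp add: k_def)
      then show "k * k = h" using t0 by (simp add: y(3) q_def)
      fix c assume "c * h = h * c"
      then have "c * q = q * c" by (simp add: q_def algebra_simps)
      then have "c * y = y * c" by (rule y(4))
      then show "c * k = k * c" by (simp add: k_def algebra_simps)
    qed
  qed
qed

lemma pos_scale: "pos h \<Longrightarrow> 0 \<le> r \<Longrightarrow> pos (r *\<^sub>R h)"
proof -
  assume h: "pos h" and r: "0 \<le> r"
  then obtain t where t: "t \<ge> 0" "norm (t *\<^sub>R 1 - h) \<le> t" by (auto simp: pos_def)
  have "(r * t) *\<^sub>R 1 - r *\<^sub>R h = r *\<^sub>R (t *\<^sub>R 1 - h)" by (simp add: algebra_simps)
  then have "norm ((r * t) *\<^sub>R 1 - r *\<^sub>R h) \<le> r * t" using t r by (simp add: mult_left_mono)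
  then show ?thesis using h r t unfolding pos_def by (auto simp: adj_scaleR intro!: exI[of _ "r * t"])
qed

lemma pos_add: "pos h \<Longrightarrow> pos k \<Longrightarrow> pos (h + k)"
proof -
  assume h: "pos h" and k: "pos k"
  then obtain s t where t: "t \<ge> 0" "norm (t *\<^sub>R 1 - h) \<le> t" and s: "s \<ge> 0" "norm (s *\<^sub>R 1 - k) \<le> s"
    by (auto simp: pos_def)
  have "(t + s) *\<^sub>R 1 - (h + k) = (t *\<^sub>R 1 - h) + (s *\<^sub>R 1 - k)" by (simp add: algebra_simps)
  then have "norm ((t + s) *\<^sub>R 1 - (h + k)) \<le> t + s"
    using t s by (smt (verit) norm_triangle_ineq)
  then show ?thesis using h k s t unfolding pos_def
    by (auto simp: adj_add intro!: exI[of _ "t + s"])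
qed

lemma pos_norm_minus: "adj h = h \<Longrightarrow> norm h \<le> t \<Longrightarrow> pos (t *\<^sub>R 1 - h)"
  unfolding pos_def using norm_ge_zero[of h]
  by (intro conjI exI[of _ t]) (simp_all add: adj_diff adj_scaleR del: norm_ge_zero)

text \<open>If \<open>norm k = 1\<close>, then \<open>1 - k\<^sup>2\<close> has a self-adjoint square root commuting with \<open>k\<close>, and
  \<open>norm_le_sum_squares\<close> bounds its square by \<open>norm 1\<close>.\<close>

lemma pos_square:
  assumes "adj h = (h::'a::unital_cstar_algebra)" shows "pos (h * h)"
proof (cases "h = 0")
  case True
  then show ?thesis by (auto simp: pos_def)
next
  case False
  define s where "s = norm h"
  have s: "s > 0" using False by (simp add: s_def)
  define k where "k = (1 / s) *\<^sub>R h"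
  have k: "adj k = k" "norm k = 1" using s by (simp_all add: k_def adj_scaleR assms s_def)
  have "norm (k * k) \<le> 1" using k norm_sa_square[of k] by simp
  then obtain y where y: "adj y = y" "(1 - y) * (1 - y) = 1 - k * k"
      "\<And>c. c * (k * k) = k * k * c \<Longrightarrow> c * y = y * c"
    using sqrt_one_minus[of "k * k"] k by (auto simp: adj_mult)
  have "k * y = y * k" by (rule y(3)) (simp add: mult.assoc)
  then have "(norm (1 - y))\<^sup>2 \<le> norm ((1 - y) * (1 - y) + k * k)"
    by (intro norm_le_sum_squares) (auto simp: adj_diff y k algebra_simps)
  then have "norm (1 - k * k) \<le> 1" using norm_sa_square[of "1 - y"] y by (simp add: adj_diff)
  then have "pos (k * k)" unfolding pos_def by (auto simp: adj_mult k intro!: exI[of _ 1])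
  then have "pos ((s * s) *\<^sub>R (k * k))" using s by (intro pos_scale) auto
  then show ?thesis using s by (simp add: k_def)
qed

lemma pos_commute_mult:
  assumes "pos a" "pos b" "a * b = b * a" shows "pos (a * b)"
proof -
  obtain k where k: "pos k" "k * k = a" "\<And>c. c * a = a * c \<Longrightarrow> c * k = k * c"
    using pos_sqrt[OF assms(1)] by metis
  obtain l where l: "pos l" "l * l = b" "\<And>c. c * b = b * c \<Longrightarrow> c * l = l * c"
    using pos_sqrt[OF assms(2)] by metis
  have "b * k = k * b" using k(3) assms(3) by simp
  then have kl: "k * l = l * k" using l(3)[of k] by simp
  then have "(k * l) * (k * l) = (k * k) * (l * l)" by (metis mult.assoc)
  moreover have "pos ((k * l) * (k * l))"
    by (rule pos_square) (simp add: adj_mult pos_sa k(1) l(1) kl)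
  ultimately show ?thesis by (simp add: k l)
qed

text \<open>The square roots of \<open>h\<close> and \<open>t - h\<close> commute and their squares add up to \<open>t\<close>. For \<open>t = 0\<close> this
  makes the cone of positive elements proper.\<close>

lemma pos_norm_bound:
  assumes "pos h" "pos (t *\<^sub>R 1 - h)" shows "norm h \<le> \<bar>t\<bar>"
proof -
  obtain k where k: "pos k" "k * k = h"
    using pos_sqrt[OF assms(1)] by metis
  obtain l where l: "pos l" "l * l = t *\<^sub>R 1 - h"
      "\<And>c. c * (t *\<^sub>R 1 - h) = (t *\<^sub>R 1 - h) * c \<Longrightarrow> c * l = l * c"
    using pos_sqrt[OF assms(2)] by metis
  have "k * h = h * k" by (metis k(2) mult.assoc)
  then have "k * l = l * k" by (intro l(3)) (simp add: algebra_simps)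
  then have "(norm k)\<^sup>2 \<le> norm (k * k + l * l)"
    by (intro norm_le_sum_squares pos_sa k(1) l(1))
  then show ?thesis using norm_sa_square[OF pos_sa[OF k(1)]] by (simp add: k(2) l(2))
qed

lemma pos_antisym: "pos h \<Longrightarrow> pos (- h) \<Longrightarrow> h = 0"
  using pos_norm_bound[of h 0] by simp

lemma pos_sum_zero: "pos h \<Longrightarrow> pos k \<Longrightarrow> pos (- (h + k)) \<Longrightarrow> h = 0"
  using pos_antisym[of h] pos_add[of k "- (h + k)"] by simp

text \<open>Twice this sum is \<open>s\<^sup>2 + r\<^sup>2\<close>, where \<open>s\<close> and \<open>r\<close> are twice the real and imaginary parts of \<open>y\<close>.\<close>

lemma pos_adj_mult_sum:
  fixes y :: "'a::unital_cstar_algebra"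
  shows "pos (adj y * y + y * adj y)"
proof -
  define s where "s = y + adj y"
  define r where "r = \<i> *\<^sub>C (y - adj y)"
  have ii: "\<i> *\<^sub>C \<i> *\<^sub>C k = - k" for k :: 'a by (simp add: scaleC_scaleC)
  have r: "adj r = r" "r * r = - ((y - adj y) * (y - adj y))"
    by (simp_all add: r_def adj_scaleC adj_diff adj_adj mult_scaleC_left mult_scaleC_right ii)
      (metis minus_diff_eq scaleC_minus_right)
  have s: "adj s = s" by (simp add: s_def adj_add adj_adj add.commute)
  have "s * s + r * r = 2 *\<^sub>R (adj y * y + y * adj y)"
    by (simp add: r(2)) (simp add: s_def algebra_simps scaleR_2)
  then have "adj y * y + y * adj y = (1/2) *\<^sub>R (s * s + r * r)" by simp
  then show ?thesis
    using pos_scale[OF pos_add[OF pos_square[OF s] pos_square[OF r(1)]], of "1/2"] by simp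
qed

text \<open>If \<open>- adj y * y = q\<close> is positive, so is \<open>p = y * adj y\<close>, by \<open>pos_adj_mult_sum\<close>. The usual proof now
  compares the spectra of \<open>adj y * y\<close> and \<open>y * adj y\<close>. Multiplying \<open>y\<close> by the square root of \<open>q\<close> avoids
  this: for the product \<open>z\<close> both \<open>adj z * z\<close> and \<open>z * adj z\<close> are negative, while their sum is
  positive.\<close>

lemma not_neg_adj_mult_self:
  fixes y :: "'a::unital_cstar_algebra"
  assumes "pos (- (adj y * y))" shows "y = 0"
proof -
  define q where "q = - (adj y * y)"
  define p where "p = y * adj y"
  have posq: "pos q" using assms by (simp add: q_def)
  then have posp: "pos p" using pos_add[OF pos_adj_mult_sum[of y] posq] by (simp add: p_def q_def)
  obtain k where k: "pos k" "k * k = q"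
    using pos_sqrt[OF posq] by metis
  \<comment> \<open>the decisive substitution: both squares of \<open>z\<close> turn out to be negative\<close>
  define z where "z = y * k"
  have az: "adj z = k * adj y" by (simp add: z_def adj_mult pos_sa[OF k(1)])
  have qy: "adj y * y = - q" by (simp add: q_def)
  have "adj z * z = k * (adj y * y) * k" by (simp only: az) (simp add: z_def mult.assoc)
  also have "\<dots> = - (k * k * (k * k))" by (simp only: qy k(2)[symmetric]) (simp add: mult.assoc)
  finally have zz1: "adj z * z = - (q * q)" by (simp add: k(2))
  have "z * adj z = y * (k * k) * adj y" by (simp only: az) (simp add: z_def mult.assoc)
  also have "\<dots> = - (y * (adj y * y) * adj y)" by (simp add: k(2) qy)
  also have "\<dots> = - (p * p)" by (simp add: p_def mult.assoc)
  finally have zz2: "z * adj z = - (p * p)" .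
  have "pos (- (q * q + p * p))" using pos_adj_mult_sum[of z] by (simp add: zz1 zz2)
  then have "q * q = 0"
    using posp posq by (intro pos_sum_zero[of "q * q" "p * p"] pos_square pos_sa) auto
  then have "q = 0" using norm_sa_square[of q] posq pos_sa by fastforce
  then show ?thesis using cstar_identity[of y] by (simp add: qy)
qed

text \<open>With \<open>h = adj x * x\<close> and \<open>m = \<bar>h\<bar>\<close>, the element \<open>n = m - h\<close> is twice the negative part of \<open>h\<close>. Since
  \<open>x * n\<close> has a negative square, it vanishes, and this forces \<open>n = 0\<close>.\<close>

theorem pos_adj_mult_self: "pos (adj x * (x::'a::unital_cstar_algebra))"
proof -
  define h where "h = adj x * x"
  have h: "adj h = h" by (simp add: h_def adj_mult adj_adj)
  obtain m where m: "pos m" "m * m = h * h" "\<And>c. c * (h * h) = h * h * c \<Longrightarrow> c * m = m * c"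
    using pos_sqrt[OF pos_square[OF h]] by metis
  have hm: "h * m = m * h" by (rule m(3)) (simp add: mult.assoc)
  define n where "n = m - h"
  have n: "adj n = n" by (simp add: n_def adj_diff h pos_sa m(1))
  have nm: "n * m = m * n" by (simp add: n_def algebra_simps hm)
  have hn: "h * n = - (m * n)" by (simp add: n_def algebra_simps hm m(2))
  have "adj (x * n) * (x * n) = n * (h * n)" by (simp add: adj_mult n h_def mult.assoc)
  then have y: "- (adj (x * n) * (x * n)) = n * n * m" by (simp add: hn nm mult.assoc)
  have "pos (n * n * m)"
    by (rule pos_commute_mult[OF pos_square[OF n] m(1)]) (metis nm mult.assoc)
  then have "x * n = 0" using not_neg_adj_mult_self[of "x * n"] y by simp
  then have "n * n * m = 0" using y by simp
  moreover have "n * n = 2 *\<^sub>R (n * m)"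
    using hn by (subst (1) n_def) (simp add: left_diff_distrib nm scaleR_2)
  ultimately have "n * n * n = 0" by (metis mult.assoc mult_scaleR_right scaleR_zero_right nm)
  then have "n = 0" using sa_nilpotent n by blast
  then show ?thesis using m(1) by (simp add: n_def h_def)
qed

section \<open>A Hahn-Banach theorem and the existence of states\<close>

definition sublinear :: "('v::real_vector \<Rightarrow> real) \<Rightarrow> bool" where
  "sublinear q \<longleftrightarrow> (\<forall>x y. q (x + y) \<le> q x + q y) \<and> (\<forall>r x. 0 \<le> r \<longrightarrow> q (r *\<^sub>R x) = r * q x)"

lemma sublinear_add: "sublinear q \<Longrightarrow> q (x + y) \<le> q x + q y"
  by (simp add: sublinear_def)

lemma sublinear_scale: "sublinear q \<Longrightarrow> 0 \<le> r \<Longrightarrow> q (r *\<^sub>R x) = r * q x"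
  by (simp add: sublinear_def)

lemma sublinear_zero: "sublinear q \<Longrightarrow> q 0 = 0"
  using sublinear_scale[of q 0 0] by simp

lemma sublinear_neg: "sublinear q \<Longrightarrow> - q (- x) \<le> q x"
  using sublinear_add[of q x "-x"] sublinear_zero[of q] by simp

lemma sublinear_Inf:
  assumes "I \<noteq> {}"
    and bdd: "\<And>x. bdd_below ((\<lambda>i. F i x) ` I)"
    and add: "\<And>i j x y. i \<in> I \<Longrightarrow> j \<in> I \<Longrightarrow> \<exists>k\<in>I. F k (x + y) \<le> F i x + F j y"
    and scale: "\<And>i r x. i \<in> I \<Longrightarrow> 0 < r \<Longrightarrow> \<exists>k\<in>I. F k (r *\<^sub>R x) \<le> r * F i x"
    and zero: "(INF i\<in>I. F i 0) = 0"
  shows "sublinear (\<lambda>x. INF i\<in>I. F i (x::'v::real_vector) :: real)"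
proof -
  let ?q = "\<lambda>x. INF i\<in>I. F i x"
  have lower: "?q x \<le> F i x" if "i \<in> I" for i x
    by (rule cINF_lower[OF bdd that])
  have "?q (x + y) \<le> ?q x + ?q y" for x y
  proof -
    have "?q (x + y) - F j y \<le> ?q x" if j: "j \<in> I" for j
    proof (rule cINF_greatest[OF assms(1)])
      fix i assume "i \<in> I"
      then obtain k where "k \<in> I" "F k (x + y) \<le> F i x + F j y" using add j by blast
      then show "?q (x + y) - F j y \<le> F i x" using lower[of k "x + y"] by simp
    qed
    then have "?q (x + y) - ?q x \<le> ?q y"
      by (intro cINF_greatest[OF assms(1)]) (simp add: algebra_simps)
    then show ?thesis by simp
  qed
  moreover have le: "?q (r *\<^sub>R x) \<le> r * ?q x" if r: "0 < r" for r x
  proof -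
    have "?q (r *\<^sub>R x) / r \<le> ?q x"
    proof (rule cINF_greatest[OF assms(1)])
      fix i assume "i \<in> I"
      then obtain k where "k \<in> I" "F k (r *\<^sub>R x) \<le> r * F i x" using scale r by blast
      then have "?q (r *\<^sub>R x) \<le> r * F i x" using lower order_trans by blast
      then show "?q (r *\<^sub>R x) / r \<le> F i x" using r by (simp add: field_simps)
    qed
    then show ?thesis using r by (simp add: field_simps)
  qed
  moreover have "?q (r *\<^sub>R x) = r * ?q x" if r: "0 \<le> r" for r x
  proof (cases "r = 0")
    case True
    then show ?thesis using zero by simp
  next
    case False
    with r have "0 < r" by simp
    have "?q x \<le> (1 / r) * ?q (r *\<^sub>R x)" using le[of "1 / r" "r *\<^sub>R x"] \<open>0 < r\<close> by simp
    then have "r * ?q x \<le> ?q (r *\<^sub>R x)" using \<open>0 < r\<close> by (simp add: field_simps)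
    with le[OF \<open>0 < r\<close>] show ?thesis by (simp add: antisym)
  qed
  ultimately show ?thesis unfolding sublinear_def by blast
qed

text \<open>For fixed \<open>y\<close>, the functional \<open>q' x = inf {q (x + t * y) - t * q y | t \<ge> 0}\<close> is the largest sublinear
  functional below \<open>q\<close> with \<open>q' (- y) \<le> - q y\<close>.\<close>

lemma sublinear_lower:
  assumes q: "sublinear (q :: 'v::real_vector \<Rightarrow> real)"
  shows "\<exists>q'. sublinear q' \<and> q' \<le> q \<and> q' (- y) \<le> - q y"
proof -
  let ?F = "\<lambda>t x. q (x + t *\<^sub>R y) - t * q y"
  let ?q = "\<lambda>x. INF t\<in>{0..}. ?F t x"
  have low: "- q (- x) \<le> ?F t x" if "0 \<le> t" for t x
    using sublinear_add[OF q, of "x + t *\<^sub>R y" "- x"] sublinear_scale[OF q that, of y] by simp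
  have bdd: "bdd_below ((\<lambda>t. ?F t x) ` {0..})" for x
    by (rule bdd_belowI2[of _ "- q (- x)"]) (use low in auto)
  have le: "?q x \<le> ?F t x" if "0 \<le> t" for t x
    by (rule cINF_lower[OF bdd]) (use that in auto)
  have "sublinear ?q"
  proof (rule sublinear_Inf)
    show "bdd_below ((\<lambda>t. ?F t x) ` {0..})" for x by (rule bdd)
    show "\<exists>k\<in>{0..}. ?F k (x + z) \<le> ?F i x + ?F j z" if "i \<in> {0..}" "j \<in> {0..}" for i j x z
      using that sublinear_add[OF q, of "x + i *\<^sub>R y" "z + j *\<^sub>R y"]
      by (intro bexI[of _ "i + j"]) (auto simp: algebra_simps)
    show "\<exists>k\<in>{0..}. ?F k (r *\<^sub>R x) \<le> r * ?F i x" if "i \<in> {0..}" "0 < r" for i r x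
      using that sublinear_scale[OF q, of r "x + i *\<^sub>R y"]
      by (intro bexI[of _ "r * i"]) (auto simp: algebra_simps)
    have "0 \<le> ?q 0" using low[of _ 0] sublinear_zero[OF q] by (intro cINF_greatest) auto
    moreover have "?q 0 \<le> 0" using le[of 0 0] sublinear_zero[OF q] by simp
    ultimately show "?q 0 = 0" by simp
  qed auto
  moreover have "?q x \<le> q x" for x using le[of 0 x] by simp
  moreover have "?q (- y) \<le> - q y" using le[of 1 "- y"] sublinear_zero[OF q] by simp
  ultimately show ?thesis by (auto simp: le_fun_def)
qed

text \<open>A minimal sublinear functional is odd, by \<open>sublinear_lower\<close>, hence linear. Minimality is
  sought below the functional that \<open>sublinear_lower\<close> provides for \<open>h\<close>, because every linear functional
  \<open>f\<close> below that one satisfies \<open>f (- h) \<le> - p h\<close>.\<close>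

theorem sublinear_dominates_linear:
  assumes p: "sublinear (p :: 'v::real_vector \<Rightarrow> real)"
  shows "\<exists>f. linear f \<and> (\<forall>x. f x \<le> p x) \<and> f h = p h"
proof -
  obtain p' where p': "sublinear p'" "p' \<le> p" "p' (- h) \<le> - p h"
    using sublinear_lower[OF p, of h] by blast
  let ?A = "{q. sublinear q \<and> q \<le> p'}" and ?P = "\<lambda>q q'. q' \<le> (q :: 'v \<Rightarrow> real)"
  have "\<exists>m\<in>?A. \<forall>q\<in>?A. ?P m q \<longrightarrow> q = m"
  proof (rule predicate_Zorn)
    show "partial_order_on ?A (relation_of ?P ?A)"
      by (rule partial_order_on_relation_ofI) auto
    fix C assume C: "C \<in> Chains (relation_of ?P ?A)"
    then have CA: "q \<in> ?A" if "q \<in> C" for q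
      using that by (auto simp: Chains_def relation_of_def)
    have chain: "q \<le> q' \<or> q' \<le> q" if "q \<in> C" "q' \<in> C" for q q'
      using C that by (auto simp: Chains_def relation_of_def)
    show "\<exists>u\<in>?A. \<forall>q\<in>C. ?P q u"
    proof (cases "C = {}")
      case True
      then show ?thesis using p'(1) by auto
    next
      case False
      let ?u = "\<lambda>x. INF q\<in>C. q x"
      have bdd: "bdd_below ((\<lambda>q. q x) ` C)" for x
      proof (rule bdd_belowI2)
        fix q assume "q \<in> C"
        then have "- q (- x) \<le> q x" "q (- x) \<le> p' (- x)"
          using CA sublinear_neg by (auto simp: le_fun_def)
        then show "- p' (- x) \<le> q x" by simp
      qed
      have low: "?u x \<le> q x" if "q \<in> C" for q x by (rule cINF_lower[OF bdd that])
      have "sublinear ?u"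
      proof (rule sublinear_Inf[OF False bdd])
        fix q q' :: "'v \<Rightarrow> real" and x y
        assume q: "q \<in> C" "q' \<in> C"
        then obtain k where k: "k \<in> C" "k \<le> q" "k \<le> q'" using chain by blast
        then have "k (x + y) \<le> k x + k y" "k x \<le> q x" "k y \<le> q' y"
          using CA[OF k(1)] sublinear_add[of k x y] by (auto simp: le_fun_def)
        then show "\<exists>k\<in>C. k (x + y) \<le> q x + q' y" using k(1) by (intro bexI[of _ k]) auto
      next
        fix q :: "'v \<Rightarrow> real" and r x assume q: "q \<in> C" and r: "0 < (r::real)"
        have "q (r *\<^sub>R x) = r * q x" using CA[OF q] r by (intro sublinear_scale) auto
        then show "\<exists>k\<in>C. k (r *\<^sub>R x) \<le> r * q x" using q by (intro bexI[of _ q]) auto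
      next
        have "(\<lambda>q. q 0) ` C = {0 :: real}" using CA sublinear_zero False by (auto simp: image_iff)
        then show "?u 0 = 0" by simp
      qed
      moreover have "?u \<le> p'"
      proof (rule le_funI)
        fix x
        obtain q where q: "q \<in> C" using False by blast
        show "?u x \<le> p' x" using low[OF q, of x] CA[OF q] by (auto simp: le_fun_def intro: order_trans)
      qed
      ultimately show ?thesis using low by (intro bexI[of _ ?u]) (auto intro: le_funI)
    qed
  qed
  then obtain m where m: "sublinear m" "m \<le> p'" and
    min: "\<And>q. sublinear q \<Longrightarrow> q \<le> p' \<Longrightarrow> q \<le> m \<Longrightarrow> q = m" by auto
  have odd: "m (- y) = - m y" for y
  proof -
    obtain q where q: "sublinear q" "q \<le> m" "q (- y) \<le> - m y"
      using sublinear_lower[OF m(1), of y] by blast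
    then have "q = m" using min m(2) order_trans by blast
    then show ?thesis using q(3) sublinear_neg[OF m(1), of y] by simp
  qed
  have "linear m"
  proof (rule linearI)
    fix x y
    have "m (x + y + (- y)) \<le> m (x + y) + m (- y)" by (rule sublinear_add[OF m(1)])
    then show "m (x + y) = m x + m y" using sublinear_add[OF m(1), of x y] odd[of y] by simp
  next
    fix r :: real and x
    show "m (r *\<^sub>R x) = r *\<^sub>R m x"
      using sublinear_scale[OF m(1), of r x] sublinear_scale[OF m(1), of "- r" x] odd[of "r *\<^sub>R x"]
      by (cases "0 \<le> r") auto
  qed
  moreover have "m x \<le> p x" for x using m(2) p'(2) by (meson le_funD order_trans)
  moreover have "p h \<le> m h" using p'(3) le_funD[OF m(2), of "- h"] odd[of h] by simp
  ultimately show ?thesis by (metis antisym)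
qed

definition re_part :: "'a::unital_cstar_algebra \<Rightarrow> 'a" where
  "re_part x = (1/2) *\<^sub>R (x + adj x)"

lemma re_part_sa: "adj h = h \<Longrightarrow> re_part h = h"
  by (simp add: re_part_def flip: scaleR_2)

lemma adj_re_part: "adj (re_part x) = re_part x"
  by (simp add: re_part_def adj_scaleR adj_add adj_adj add.commute)

lemma re_part_add: "re_part (x + y) = re_part x + re_part y"
  by (simp add: re_part_def adj_add algebra_simps)

lemma re_part_scale: "re_part (r *\<^sub>R x) = r *\<^sub>R re_part x"
  by (simp add: re_part_def adj_scaleR algebra_simps)

text \<open>This is the largest point in the spectrum of the real part of \<open>x\<close>. Linear functionals below it
  vanish on skew-adjoint elements and are nonnegative on positive ones.\<close>

definition spectral_sup :: "'a::unital_cstar_algebra \<Rightarrow> real" where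
  "spectral_sup x = Inf {t. pos (t *\<^sub>R 1 - re_part x)}"

lemma pos_one: "0 \<le> t \<Longrightarrow> pos (t *\<^sub>R (1::'a::unital_cstar_algebra))"
  using pos_norm_minus[of "0::'a" t] by simp

lemma pos_minus_re_part_lower:
  assumes "pos (t *\<^sub>R 1 - re_part (x::'a::unital_cstar_algebra))" shows "- norm (re_part x) \<le> t"
proof (rule ccontr)
  assume "\<not> - norm (re_part x) \<le> t"
  define s where "s = - (norm (re_part x) + t)"
  with \<open>\<not> _\<close> have s: "s > 0" by simp
  have "pos (norm (re_part x) *\<^sub>R 1 - (- re_part x))"
    by (rule pos_norm_minus) (simp_all add: adj_re_part)
  from pos_add[OF this assms] have "pos (- (s *\<^sub>R (1::'a)))" by (simp add: s_def algebra_simps)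
  then have "s *\<^sub>R (1::'a) = 0" using pos_antisym[OF pos_one[of s]] s by simp
  with s show False by simp
qed

lemma spectral_sup_le: "pos (t *\<^sub>R 1 - re_part x) \<Longrightarrow> spectral_sup x \<le> t"
  unfolding spectral_sup_def
  by (rule cInf_lower) (auto intro!: bdd_belowI[of _ "- norm (re_part x)"] pos_minus_re_part_lower)

lemma spectral_sup_attained_nearly:
  assumes "spectral_sup x < t" obtains s where "s < t" "pos (s *\<^sub>R 1 - re_part x)"
proof -
  have "{t. pos (t *\<^sub>R 1 - re_part x)} \<noteq> {}"
    using pos_norm_minus[OF adj_re_part order_refl, of x] by blast
  from cInf_lessD[OF this] assms that show thesis unfolding spectral_sup_def by blast
qed

lemma sublinear_spectral_sup: "sublinear (spectral_sup :: 'a::unital_cstar_algebra \<Rightarrow> real)"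
proof -
  have add: "spectral_sup (x + y) \<le> spectral_sup x + spectral_sup y" for x y :: 'a
  proof (rule field_le_epsilon)
    fix e :: real assume "0 < e"
    obtain s where s: "s < spectral_sup x + e / 2" "pos (s *\<^sub>R 1 - re_part x)"
      using spectral_sup_attained_nearly[of x "spectral_sup x + e / 2"] \<open>0 < e\<close> by auto
    obtain t where t: "t < spectral_sup y + e / 2" "pos (t *\<^sub>R 1 - re_part y)"
      using spectral_sup_attained_nearly[of y "spectral_sup y + e / 2"] \<open>0 < e\<close> by auto
    have "pos ((s + t) *\<^sub>R 1 - re_part (x + y))"
      using pos_add[OF s(2) t(2)] by (simp add: re_part_add algebra_simps)
    then show "spectral_sup (x + y) \<le> spectral_sup x + spectral_sup y + e" using spectral_sup_le s t by fastforce
  qed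
  have le: "spectral_sup (r *\<^sub>R x) \<le> r * spectral_sup x" if r: "0 < r" for r and x :: 'a
  proof (rule field_le_epsilon)
    fix e :: real assume "0 < e"
    obtain s where s: "s < spectral_sup x + e / r" "pos (s *\<^sub>R 1 - re_part x)"
      using spectral_sup_attained_nearly[of x "spectral_sup x + e / r"] \<open>0 < e\<close> r by auto
    have "pos ((r * s) *\<^sub>R 1 - re_part (r *\<^sub>R x))"
      using pos_scale[OF s(2), of r] r by (simp add: re_part_scale algebra_simps)
    moreover have "r * s \<le> r * spectral_sup x + e" using s(1) r by (simp add: field_simps)
    ultimately show "spectral_sup (r *\<^sub>R x) \<le> r * spectral_sup x + e" using spectral_sup_le by fastforce
  qed
  have zero: "spectral_sup (0::'a) = 0"
  proof -
    have re0: "re_part 0 = (0::'a)" by (simp add: re_part_def)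
    have "spectral_sup (0::'a) \<le> 0" using pos_one[of 0] by (intro spectral_sup_le) (simp add: re0)
    moreover have "0 \<le> spectral_sup (0::'a)"
    proof (rule ccontr)
      assume "\<not> 0 \<le> spectral_sup (0::'a)"
      then obtain s where "s < 0" "pos (s *\<^sub>R 1 - re_part (0::'a))"
        using spectral_sup_attained_nearly[of "0::'a" 0] by auto
      then show False using pos_minus_re_part_lower[of s "0::'a"] by (simp add: re0)
    qed
    ultimately show ?thesis by simp
  qed
  have "spectral_sup (r *\<^sub>R x) = r * spectral_sup x" if r: "0 \<le> r" for r and x :: 'a
  proof (cases "r = 0")
    case False
    with r have "0 < r" by simp
    have "spectral_sup x \<le> (1 / r) * spectral_sup (r *\<^sub>R x)" using le[of "1 / r" "r *\<^sub>R x"] \<open>0 < r\<close> by simp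
    with le[OF \<open>0 < r\<close>, of x] \<open>0 < r\<close> show ?thesis by (simp add: field_simps)
  qed (simp add: zero)
  with add show ?thesis unfolding sublinear_def by blast
qed

lemma spectral_sup_neg: "pos h \<Longrightarrow> spectral_sup (- h) \<le> 0"
  by (rule spectral_sup_le) (simp add: re_part_sa pos_sa)

text \<open>If the supremum were at most \<open>0\<close>, then \<open>t - h\<close> would be positive with \<open>t = norm h / 2\<close>, against
  \<open>pos_norm_bound\<close>.\<close>

lemma spectral_sup_pos:
  assumes "pos h" "h \<noteq> 0" shows "0 < spectral_sup h"
proof (rule ccontr)
  assume "\<not> 0 < spectral_sup h"
  moreover have "0 < norm h" using assms(2) by simp
  ultimately have "spectral_sup h < norm h / 2" by linarith
  then obtain s where s: "s < norm h / 2" "pos (s *\<^sub>R 1 - re_part h)"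
    by (rule spectral_sup_attained_nearly)
  then have "pos ((norm h / 2 - s) *\<^sub>R 1 + (s *\<^sub>R 1 - h))"
    using pos_add[OF pos_one[of "norm h / 2 - s"]] by (simp add: re_part_sa pos_sa[OF assms(1)])
  then have "norm h \<le> norm h / 2"
    using pos_norm_bound[OF assms(1), of "norm h / 2"] by (simp add: scaleR_diff_left)
  with assms(2) show False by simp
qed

locale positive_functional =
  fixes \<phi> :: "'a::unital_cstar_algebra \<Rightarrow> complex"
  assumes additive: "\<phi> (x + y) = \<phi> x + \<phi> y"
    and homogeneous: "\<phi> (c *\<^sub>C x) = c * \<phi> x"
    and adjoint: "\<phi> (adj x) = cnj (\<phi> x)"
    and positive: "0 \<le> Re (\<phi> (adj x * x))"
begin

lemma semi_inner: "semi_inner (\<lambda>x y. \<phi> (adj y * x))"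
proof
  show "\<phi> (adj x * y) = cnj (\<phi> (adj y * x))" for x y
    using adjoint[of "adj y * x"] by (simp add: adj_mult adj_adj)
qed (simp_all add: algebra_simps additive homogeneous mult_scaleC_right positive)

text \<open>The difference of the two sides is the value of \<open>\<phi>\<close> at \<open>adj (k * x) * (k * x)\<close>, where \<open>k\<close> is the square
  root of \<open>(norm a)\<^sup>2 - adj a * a\<close>. This single estimate yields the boundedness of the operators of a
  \<open>star_matrix\<close>, the contractivity of representations and the continuity of the form
  \<open>\<phi> (adj y * x)\<close>.\<close>

lemma bound: "Re (\<phi> (adj (a * x) * (a * x))) \<le> (norm a)\<^sup>2 * Re (\<phi> (adj x * x))"
proof -
  have "pos ((norm a)\<^sup>2 *\<^sub>R 1 - adj a * a)"
    by (rule pos_norm_minus) (simp_all add: adj_mult adj_adj cstar_identity)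
  then obtain k where k: "pos k" "k * k = (norm a)\<^sup>2 *\<^sub>R 1 - adj a * a" by (rule pos_sqrt)
  have "adj (k * x) * (k * x) = adj x * (k * k) * x" by (simp add: adj_mult pos_sa[OF k(1)] mult.assoc)
  also have "\<dots> = (norm a)\<^sup>2 *\<^sub>R (adj x * x) - adj (a * x) * (a * x)"
    unfolding k(2) by (simp add: algebra_simps adj_mult)
  finally have eq: "(norm a)\<^sup>2 *\<^sub>R (adj x * x) = adj (k * x) * (k * x) + adj (a * x) * (a * x)" by simp
  have "of_real ((norm a)\<^sup>2) * \<phi> (adj x * x) = \<phi> (adj (k * x) * (k * x)) + \<phi> (adj (a * x) * (a * x))"
    using arg_cong[OF eq, of \<phi>] by (simp add: additive scaleR_scaleC homogeneous)
  from arg_cong[OF this, of Re] show ?thesis using positive[of "k * x"] by simp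
qed

end

text \<open>A real functional \<open>f\<close> below \<open>spectral_sup\<close> that agrees with it at \<open>adj b * b\<close> is complexified by
  \<open>x \<mapsto> f x - \<i> f (\<i> x)\<close>; its values on self-adjoint elements are real because \<open>f\<close> kills the
  skew-adjoint ones.\<close>

theorem exists_positive_functional:
  fixes b :: "'a::unital_cstar_algebra"
  assumes "b \<noteq> 0"
  obtains \<phi> :: "'a \<Rightarrow> complex" where "positive_functional \<phi>" "0 < Re (\<phi> (adj b * b))"
proof -
  have "adj b * b \<noteq> 0" using assms cstar_identity[of b] by auto
  obtain f where f: "linear f" "\<And>x. f x \<le> spectral_sup x" "f (adj b * b) = spectral_sup (adj b * b)"
    using sublinear_dominates_linear[OF sublinear_spectral_sup] by blast
  have fpos: "0 \<le> f h" if "pos h" for h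
    using f(2)[of "- h"] spectral_sup_neg[OF that] linear_neg[OF f(1), of h] by simp
  have skew: "f x = 0" if "adj x = - x" for x
  proof -
    have "spectral_sup y \<le> 0" if "adj y = - y" for y :: 'a
      using that pos_one[of 0] by (intro spectral_sup_le) (simp add: re_part_def)
    from f(2)[of x] f(2)[of "- x"] this[of x] this[of "- x"] that show ?thesis
      by (simp add: linear_neg[OF f(1)])
  qed
  have fadj: "f (adj x) = f x" for x
    using skew[of "x - adj x"] by (simp add: adj_diff adj_adj linear_diff[OF f(1)])
  define \<phi> where "\<phi> x = Complex (f x) (- f (\<i> *\<^sub>C x))" for x
  have ii: "\<i> *\<^sub>C \<i> *\<^sub>C k = - k" for k :: 'a by (simp add: scaleC_scaleC)
  have split: "c *\<^sub>C x = Re c *\<^sub>R x + Im c *\<^sub>R (\<i> *\<^sub>C x)" for c and x :: 'a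
    unfolding scaleR_scaleC scaleC_scaleC scaleC_add_left[symmetric]
    by (metis complex_eq mult.commute)
  have fc: "f (c *\<^sub>C x) = Re c * f x + Im c * f (\<i> *\<^sub>C x)" for c and x :: 'a
    by (subst split) (simp add: linear_add[OF f(1)] linear_scale[OF f(1)])
  have "positive_functional \<phi>"
  proof
    show "\<phi> (x + y) = \<phi> x + \<phi> y" for x y
      by (simp add: \<phi>_def scaleC_add_right linear_add[OF f(1)] complex_eq_iff)
    show "\<phi> (c *\<^sub>C x) = c * \<phi> x" for c x
      using fc[of c x] fc[of "\<i> * c" x]
      by (simp add: \<phi>_def scaleC_scaleC complex_eq_iff)
    show "\<phi> (adj x) = cnj (\<phi> x)" for x
      using fadj[of x] fadj[of "\<i> *\<^sub>C x"] by (simp add: \<phi>_def adj_scaleC complex_eq_iff linear_neg[OF f(1)])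
    show "0 \<le> Re (\<phi> (adj x * x))" for x
      using fpos[OF pos_adj_mult_self] by (simp add: \<phi>_def)
  qed
  moreover have "0 < Re (\<phi> (adj b * b))"
    using f(3) spectral_sup_pos[OF pos_adj_mult_self \<open>adj b * b \<noteq> 0\<close>] by (simp add: \<phi>_def)
  ultimately show thesis by (rule that)
qed

section \<open>Orthonormalisation in a separable semi-inner product space\<close>

context semi_inner
begin

lemma seminorm_zero [simp]: "seminorm 0 = 0"
  by (simp add: seminorm_def)

lemma seminorm_scale: "seminorm (c *\<^sub>C x) = cmod c * seminorm x"
proof -
  have "g (c *\<^sub>C x) (c *\<^sub>C x) = of_real ((cmod c)\<^sup>2 * (seminorm x)\<^sup>2)"
    unfolding scale_left scale_right self_sn[of x] by (simp only: of_real_mult complex_norm_square mult_ac)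
  then have "(seminorm (c *\<^sub>C x))\<^sup>2 = (cmod c * seminorm x)\<^sup>2" by (simp add: seminorm_square power_mult_distrib)
  then show ?thesis by (rule power2_eq_imp_eq) simp_all
qed

text \<open>Vectors that depend on their predecessors up to a null vector are sent to \<open>0\<close> instead of being
  dropped, so that the output keeps the indices of the input; \<open>orthonormal\<close> accordingly tolerates
  zero entries.\<close>

function gram_schmidt :: "(nat \<Rightarrow> 'v) \<Rightarrow> nat \<Rightarrow> 'v" where
  "gram_schmidt d n =
    (let r = d n - (\<Sum>k<n. g (d n) (gram_schmidt d k) *\<^sub>C gram_schmidt d k)
     in if seminorm r = 0 then 0 else complex_of_real (1 / seminorm r) *\<^sub>C r)"
  by pat_completeness auto
termination by (relation "Wellfounded.measure snd") auto

declare gram_schmidt.simps [simp del]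

definition orthonormal :: "(nat \<Rightarrow> 'v) \<Rightarrow> bool" where
  "orthonormal e \<longleftrightarrow> (\<forall>m n. g (e m) (e n) = (if m = n \<and> e n \<noteq> 0 then 1 else 0))"

definition proj :: "(nat \<Rightarrow> 'v) \<Rightarrow> nat \<Rightarrow> 'v \<Rightarrow> 'v" where
  "proj e N x = (\<Sum>k<N. g x (e k) *\<^sub>C e k)"

lemma proj_Suc: "proj e (Suc N) x = proj e N x + g x (e N) *\<^sub>C e N"
  by (simp add: proj_def)

lemma proj_diff: "proj e N (x - y) = proj e N x - proj e N y"
  by (simp add: proj_def diff_left scaleC_diff_left sum_subtractf)

lemma proj_orthogonal:
  assumes "\<And>k. k < N \<Longrightarrow> g (e k) (e m) = (if k = m \<and> e m \<noteq> 0 then 1 else 0)" "m < N"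
  shows "g (x - proj e N x) (e m) = 0"
proof -
  have "g (proj e N x) (e m) = (\<Sum>k<N. g x (e k) * (if k = m \<and> e m \<noteq> 0 then 1 else 0))"
    using assms(1) by (simp add: proj_def sum_left scale_left)
  also have "\<dots> = (\<Sum>k<N. if k = m then g x (e m) else 0)"
    by (rule sum.cong) auto
  finally show ?thesis using assms(2) by (simp add: diff_left)
qed

lemma gram_schmidt_scaled:
  "let r = d n - proj (gram_schmidt d) n (d n) in
    seminorm r = 0 \<and> gram_schmidt d n = 0 \<or>
    seminorm r \<noteq> 0 \<and> gram_schmidt d n = complex_of_real (1 / seminorm r) *\<^sub>C r"
  using gram_schmidt.simps[of d n] by (auto simp: Let_def proj_def)

lemma orthonormal_gram_schmidt: "orthonormal (gram_schmidt d)"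
proof -
  define e where "e = gram_schmidt d"
  have "e n = 0 \<or> seminorm (e n) = 1" for n
    using gram_schmidt_scaled[of d n]
    by (auto simp: Let_def e_def[symmetric] seminorm_scale norm_divide)
  then have self: "g (e n) (e n) = (if e n \<noteq> 0 then 1 else 0)" for n
    unfolding self_sn by (metis of_real_1 of_real_0 one_power2 zero_power2 seminorm_zero)
  have lower: "g (e n) (e m) = 0" if "m < n" for m n
    using that
  proof (induction n arbitrary: m rule: less_induct)
    case (less n)
    note IH = less.IH
    have "g (e k) (e m) = (if k = m \<and> e m \<noteq> 0 then 1 else 0)" if "k < n" for k
    proof (cases k m rule: linorder_cases)
      case less
      with \<open>m < n\<close> have "g (e m) (e k) = 0" using IH[of m k] less by simp
      then show ?thesis using less herm[of "e m" "e k"] by simp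
    next
      case greater
      then show ?thesis using IH[OF that] by auto
    qed (use self in auto)
    then have "g (d n - proj e n (d n)) (e m) = 0" using \<open>m < n\<close> by (rule proj_orthogonal)
    then show ?case using gram_schmidt_scaled[of d n] by (auto simp: Let_def e_def[symmetric] scale_left)
  qed
  have "g (e m) (e n) = (if m = n \<and> e n \<noteq> 0 then 1 else 0)" for m n
    using lower[of m n] lower[of n m] self[of n] herm[of "e m" "e n"]
    by (cases m n rule: linorder_cases) auto
  then show ?thesis unfolding orthonormal_def e_def by blast
qed

lemma residual:
  assumes "orthonormal e"
  shows "(seminorm (x - proj e N x))\<^sup>2 = (seminorm x)\<^sup>2 - (\<Sum>k<N. (cmod (g x (e k)))\<^sup>2)"
proof -
  have orth: "g (x - proj e N x) (e m) = 0" if "m < N" for m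
    using assms that by (intro proj_orthogonal) (auto simp: orthonormal_def)
  have "g (x - proj e N x) (x - proj e N x) = g (x - proj e N x) x"
    by (subst (2) proj_def) (simp add: diff_right sum_right scale_right orth)
  also have "\<dots> = g x x - (\<Sum>k<N. g x (e k) * g (e k) x)"
    by (simp add: diff_left proj_def sum_left scale_left)
  also have "\<dots> = g x x - (\<Sum>k<N. of_real ((cmod (g x (e k)))\<^sup>2))"
    unfolding complex_norm_square by (metis herm)
  finally show ?thesis by (simp add: seminorm_square)
qed

lemma residual_antimono:
  assumes "orthonormal e" "M \<le> N" shows "seminorm (x - proj e N x) \<le> seminorm (x - proj e M x)"
proof -
  have "(\<Sum>k<M. (cmod (g x (e k)))\<^sup>2) \<le> (\<Sum>k<N. (cmod (g x (e k)))\<^sup>2)"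
    using assms(2) by (intro sum_mono2) auto
  then have "(seminorm (x - proj e N x))\<^sup>2 \<le> (seminorm (x - proj e M x))\<^sup>2"
    by (simp add: residual[OF assms(1)])
  then show ?thesis by (rule power2_le_imp_le) simp
qed

lemma residual_gram_schmidt:
  assumes "n < N" shows "seminorm (d n - proj (gram_schmidt d) N (d n)) = 0"
proof -
  define e where "e = gram_schmidt d"
  have e: "orthonormal e" unfolding e_def by (rule orthonormal_gram_schmidt)
  let ?r = "d n - proj e n (d n)"
  have "seminorm (d n - proj e (Suc n) (d n)) = 0"
  proof (cases "seminorm ?r = 0")
    case True
    then show ?thesis using gram_schmidt_scaled[of d n] by (simp add: Let_def e_def[symmetric] proj_Suc)
  next
    case False
    then have en: "e n = complex_of_real (1 / seminorm ?r) *\<^sub>C ?r"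
      using gram_schmidt_scaled[of d n] by (simp add: Let_def e_def[symmetric])
    have r: "?r = complex_of_real (seminorm ?r) *\<^sub>C e n" using False by (simp add: en scaleC_scaleC)
    have "e n \<noteq> 0"
      using False r by (metis scaleC_zero_right seminorm_def zero_left real_sqrt_zero zero_complex.simps(1))
    then have 1: "g (e n) (e n) = 1" using e by (simp add: orthonormal_def)
    have "g (proj e n (d n)) (e n) = 0"
      using e by (simp add: proj_def sum_left scale_left orthonormal_def)
    then have "g (d n) (e n) = g ?r (e n)" by (simp add: diff_left)
    also have "\<dots> = complex_of_real (seminorm ?r)" by (subst r) (simp add: scale_left 1)
    finally have "d n - proj e (Suc n) (d n) = ?r - complex_of_real (seminorm ?r) *\<^sub>C e n"
      by (simp add: proj_Suc)
    also have "\<dots> = 0" using r by simp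
    finally show ?thesis by (simp add: seminorm_def)
  qed
  then show ?thesis using residual_antimono[OF e, of "Suc n" N "d n"] assms seminorm_nonneg
    unfolding e_def by (metis Suc_leI antisym)
qed

text \<open>The residual map is contractive for the seminorm and sends \<open>d n\<close> to a null vector from
  index \<open>n + 1\<close> on, so an approximation of \<open>x\<close> by \<open>d n\<close> bounds all later residuals of \<open>x\<close>.\<close>

lemma residual_tendsto_zero:
  assumes dense: "\<And>x \<epsilon>. 0 < \<epsilon> \<Longrightarrow> \<exists>n. seminorm (x - d n) < \<epsilon>"
  shows "(\<lambda>N. seminorm (x - proj (gram_schmidt d) N x)) \<longlonglongrightarrow> 0"
proof (rule LIMSEQ_I)
  fix \<epsilon> :: real assume "0 < \<epsilon>"
  then obtain n where n: "seminorm (x - d n) < \<epsilon>" using dense by blast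
  have "seminorm (x - proj (gram_schmidt d) N x) < \<epsilon>" if "Suc n \<le> N" for N
  proof -
    let ?P = "proj (gram_schmidt d) N"
    have "x - ?P x = ((x - d n) - ?P (x - d n)) + (d n - ?P (d n))" by (simp add: proj_diff)
    then have "seminorm (x - ?P x) \<le> seminorm ((x - d n) - ?P (x - d n)) + seminorm (d n - ?P (d n))"
      by (metis seminorm_triangle)
    also have "seminorm (d n - ?P (d n)) = 0" using that by (intro residual_gram_schmidt) simp
    also have "seminorm ((x - d n) - ?P (x - d n)) \<le> seminorm (x - d n)"
      using residual_antimono[OF orthonormal_gram_schmidt, of 0 N "x - d n" d] by (simp add: proj_def)
    finally show ?thesis using n by simp
  qed
  then show "\<exists>M. \<forall>N\<ge>M. norm (seminorm (x - proj (gram_schmidt d) N x) - 0) < \<epsilon>"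
    by auto
qed

text \<open>The sum is stated as an unconditional one over the nonzero members because these get
  re-enumerated when multiplicities are introduced.\<close>

theorem parseval:
  assumes dense: "\<And>x \<epsilon>. 0 < \<epsilon> \<Longrightarrow> \<exists>n. seminorm (x - d n) < \<epsilon>"
  defines "e \<equiv> gram_schmidt d"
  shows "((\<lambda>n. g x (e n) * g (e n) y) has_sum g x y) {n. e n \<noteq> 0}"
proof -
  have lim: "(\<lambda>N. seminorm (x - proj e N x)) \<longlonglongrightarrow> 0" for x
    unfolding e_def by (rule residual_tendsto_zero[OF dense])
  have e: "orthonormal e" unfolding e_def by (rule orthonormal_gram_schmidt)
  have sums: "(\<lambda>n. g x (e n) * g (e n) y) sums g x y"
    unfolding sums_def
  proof (rule LIM_zero_cancel, rule Lim_null_comparison)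
    have "g x y - (\<Sum>k<N. g x (e k) * g (e k) y) = g (x - proj e N x) y" for N
      by (simp add: diff_left proj_def sum_left scale_left)
    then show "\<forall>\<^sub>F N in sequentially. norm ((\<Sum>k<N. g x (e k) * g (e k) y) - g x y)
        \<le> seminorm (x - proj e N x) * seminorm y"
      by (intro always_eventually allI) (metis Cauchy_Schwarz norm_minus_commute)
    show "(\<lambda>N. seminorm (x - proj e N x) * seminorm y) \<longlonglongrightarrow> 0"
      by (rule tendsto_mult_left_zero[OF lim])
  qed
  have square: "summable (\<lambda>n. (cmod (g x (e n)))\<^sup>2)" for x
  proof -
    have "(\<lambda>N. (seminorm x)\<^sup>2 - (seminorm (x - proj e N x))\<^sup>2) \<longlonglongrightarrow> (seminorm x)\<^sup>2 - 0\<^sup>2"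
      by (intro tendsto_intros lim)
    then show ?thesis by (simp add: residual[OF e] summable_def sums_def) blast
  qed
  have "summable (\<lambda>n. norm (g x (e n) * g (e n) y))"
  proof (rule summable_comparison_test')
    show "summable (\<lambda>n. (cmod (g x (e n)))\<^sup>2 + (cmod (g y (e n)))\<^sup>2)"
      by (intro summable_add square)
    show "norm (norm (g x (e n) * g (e n) y)) \<le> (cmod (g x (e n)))\<^sup>2 + (cmod (g y (e n)))\<^sup>2" for n
    proof -
      have eq: "cmod (g (e n) y) = cmod (g y (e n))" by (metis herm complex_mod_cnj)
      moreover have "0 \<le> cmod (g x (e n)) * cmod (g y (e n))" by simp
      ultimately have "cmod (g x (e n) * g (e n) y) \<le> (cmod (g x (e n)))\<^sup>2 + (cmod (g y (e n)))\<^sup>2"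
        using sum_squares_bound[of "cmod (g x (e n))" "cmod (g y (e n))"]
        unfolding norm_mult eq mult.assoc by linarith
      then show ?thesis by simp
    qed
  qed
  from norm_summable_imp_has_sum[OF this sums]
  have "((\<lambda>n. g x (e n) * g (e n) y) has_sum g x y) UNIV" .
  then show ?thesis
    by (subst has_sum_cong_neutral[where T = UNIV and g = "\<lambda>n. g x (e n) * g (e n) y"]) auto
qed

end

section \<open>Operators on square-summable sequences given by matrices\<close>

lemma ell2_eqI: "(\<And>n. ell2_nth x n = ell2_nth y n) \<Longrightarrow> x = y"
  by (simp add: ell2_nth_inject[symmetric] fun_eq_iff)

lemma summable_ell2_inner: "summable (\<lambda>n. ell2_nth x n * cnj (ell2_nth y n))"
proof (rule summable_comparison_test')
  show "summable (\<lambda>n. (cmod (ell2_nth x n))\<^sup>2 + (cmod (ell2_nth y n))\<^sup>2)"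
    by (intro summable_add summable_ell2)
  fix n
  have "0 \<le> cmod (ell2_nth x n) * cmod (ell2_nth y n)" by simp
  then show "norm (ell2_nth x n * cnj (ell2_nth y n)) \<le> (cmod (ell2_nth x n))\<^sup>2 + (cmod (ell2_nth y n))\<^sup>2"
    using sum_squares_bound[of "cmod (ell2_nth x n)" "cmod (ell2_nth y n)"]
    unfolding norm_mult complex_mod_cnj mult.assoc by linarith
qed

lemma ell2_inner_self: "ell2_inner x x = of_real ((norm x)\<^sup>2)"
proof -
  have "0 \<le> (\<Sum>n. (cmod (ell2_nth x n))\<^sup>2)" by (intro suminf_nonneg summable_ell2) simp
  then have "(norm x)\<^sup>2 = (\<Sum>n. (cmod (ell2_nth x n))\<^sup>2)" by (simp add: norm_ell2_def)
  moreover have "ell2_inner x x = (\<Sum>n. of_real ((cmod (ell2_nth x n))\<^sup>2))"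
    unfolding ell2_inner_def complex_norm_square ..
  ultimately show ?thesis using suminf_of_real[OF summable_ell2[of x], where 'a = complex] by simp
qed

interpretation ell2: semi_inner ell2_inner
  rewrites "semi_inner.seminorm ell2_inner = norm"
proof -
  show "semi_inner ell2_inner"
  proof
    show "ell2_inner (x + y) z = ell2_inner x z + ell2_inner y z" for x y z
      unfolding ell2_inner_def
      by (subst suminf_add[OF summable_ell2_inner summable_ell2_inner])
        (simp add: plus_ell2.rep_eq distrib_right)
    show "ell2_inner (c *\<^sub>C x) z = c * ell2_inner x z" for c x z
      unfolding ell2_inner_def
      by (subst suminf_mult[OF summable_ell2_inner, symmetric]) (simp add: scaleC_ell2.rep_eq mult.assoc)
    show "ell2_inner y x = cnj (ell2_inner x y)" for x y
      unfolding ell2_inner_def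
      using bounded_linear.suminf[OF bounded_linear_cnj summable_ell2_inner[of x y]]
      by (simp add: mult.commute)
    show "0 \<le> Re (ell2_inner x x)" for x by (simp add: ell2_inner_self)
  qed
  then show "semi_inner.seminorm ell2_inner = norm"
    by (auto simp: semi_inner.seminorm_def ell2_inner_self)
qed

definition unit_vec :: "nat \<Rightarrow> ell2" where
  "unit_vec n = Abs_ell2 (\<lambda>m. if m = n then 1 else 0)"

lemma ell2_nth_unit_vec: "ell2_nth (unit_vec n) m = (if m = n then 1 else 0)"
proof -
  have "summable (\<lambda>m. (cmod (if m = n then 1 else 0))\<^sup>2)"
    by (rule summable_finite[of "{n}"]) auto
  then show ?thesis unfolding unit_vec_def by (subst Abs_ell2_inverse) auto
qed

lemma ell2_inner_unit_vec: "ell2_inner x (unit_vec n) = ell2_nth x n"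
proof -
  have "ell2_inner x (unit_vec n) = (\<Sum>m\<in>{n}. ell2_nth x m * cnj (ell2_nth (unit_vec n) m))"
    unfolding ell2_inner_def by (rule suminf_finite) (auto simp: ell2_nth_unit_vec)
  then show ?thesis by (simp add: ell2_nth_unit_vec)
qed

lemma ell2_inner_unit_vec_left: "ell2_inner (unit_vec n) x = cnj (ell2_nth x n)"
  by (metis ell2.herm ell2_inner_unit_vec)

lemma unit_vec_nonzero: "unit_vec n \<noteq> 0"
  using ell2_nth_unit_vec[of n n] by (auto simp: zero_ell2.rep_eq)

text \<open>The finite sections of a sequence converge to it in norm, by the residual formula for the
  unit vectors.\<close>

lemma functional_zero:
  fixes F :: "ell2 \<Rightarrow> complex"
  assumes add: "\<And>x y. F (x + y) = F x + F y" and scale: "\<And>c x. F (c *\<^sub>C x) = c * F x"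
    and bound: "\<And>x. cmod (F x) \<le> C * norm x" and unit: "\<And>n. F (unit_vec n) = 0"
  shows "F x = 0"
proof -
  have e: "ell2.orthonormal unit_vec"
    unfolding ell2.orthonormal_def by (simp add: ell2_inner_unit_vec ell2_nth_unit_vec unit_vec_nonzero)
  have P: "F (ell2.proj unit_vec N x) = 0" for N
    using scale[of 0 0] by (induction N) (simp_all add: ell2.proj_def add scale unit)
  have diff: "F (x - y) = F x - F y" for y
    using add[of "x - y" y] by simp
  have "(norm (x - ell2.proj unit_vec N x))\<^sup>2 = (norm x)\<^sup>2 - (\<Sum>k<N. (cmod (ell2_nth x k))\<^sup>2)" for N
    by (simp add: ell2.residual[OF e] ell2_inner_unit_vec)
  moreover have "(\<lambda>N. (norm x)\<^sup>2 - (\<Sum>k<N. (cmod (ell2_nth x k))\<^sup>2)) \<longlonglongrightarrow> 0"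
  proof -
    have "(norm x)\<^sup>2 = (\<Sum>n. (cmod (ell2_nth x n))\<^sup>2)"
      unfolding norm_ell2_def
      by (simp add: suminf_nonneg[OF summable_ell2])
    then show ?thesis
      using tendsto_diff[OF tendsto_const summable_LIMSEQ[OF summable_ell2[of x]], of "(norm x)\<^sup>2"] by simp
  qed
  ultimately have "(\<lambda>N. sqrt ((norm (x - ell2.proj unit_vec N x))\<^sup>2)) \<longlonglongrightarrow> sqrt 0"
    by (intro tendsto_real_sqrt) simp
  then have "(\<lambda>N. C * norm (x - ell2.proj unit_vec N x)) \<longlonglongrightarrow> C * 0"
    by (intro tendsto_mult tendsto_const) simp
  moreover have "cmod (F x) \<le> C * norm (x - ell2.proj unit_vec N x)" for N
    using bound[of "x - ell2.proj unit_vec N x"] by (simp add: diff P)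
  ultimately have "cmod (F x) \<le> C * 0"
    by (intro LIMSEQ_le_const) auto
  then show ?thesis by simp
qed

text \<open>These are the matrix coefficients of a unital *-representation with respect to an orthonormal
  basis, of which only algebraic properties and the convergence of matrix products are required.
  Boundedness is automatic.\<close>

locale star_matrix =
  fixes t :: "'a::unital_cstar_algebra \<Rightarrow> nat \<Rightarrow> nat \<Rightarrow> complex"
  assumes entry_add: "t (a + b) k l = t a k l + t b k l"
    and entry_scale: "t (c *\<^sub>C a) k l = c * t a k l"
    and entry_adj: "t (adj a) k l = cnj (t a l k)"
    and entry_one: "t 1 k l = (if k = l then 1 else 0)"
    and entry_mult: "(\<lambda>l. t a k l * t b l m) sums t (a * b) k m"
begin

definition column :: "'a \<Rightarrow> nat \<Rightarrow> ell2" where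
  "column a l = Abs_ell2 (\<lambda>k. t a k l)"

lemma column_nth [simp]: "ell2_nth (column a l) k = t a k l"
proof -
  have "t (adj a) l k * t a k l = of_real ((cmod (t a k l))\<^sup>2)" for k
    unfolding complex_norm_square entry_adj by (rule mult.commute)
  then have "summable (\<lambda>k. complex_of_real ((cmod (t a k l))\<^sup>2))"
    using entry_mult[of "adj a" l a l] by (auto simp: sums_iff)
  then have "summable (\<lambda>k. (cmod (t a k l))\<^sup>2)" by (simp only: summable_of_real_iff)
  then show ?thesis unfolding column_def by (subst Abs_ell2_inverse) auto
qed

lemma column_inner: "ell2_inner (column a l) (column b m) = t (adj b * a) m l"
  using entry_mult[of "adj b" m a l]
  unfolding ell2_inner_def column_nth by (simp add: sums_iff entry_adj mult.commute)

lemma column_add: "column (a + b) l = column a l + column b l"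
  by (rule ell2_eqI) (simp add: plus_ell2.rep_eq entry_add)

lemma column_scale: "column (c *\<^sub>C a) l = c *\<^sub>C column a l"
  by (rule ell2_eqI) (simp add: scaleC_ell2.rep_eq entry_scale)

lemma column_one: "column 1 l = unit_vec l"
  by (rule ell2_eqI) (simp add: ell2_nth_unit_vec entry_one)

text \<open>The square of the norm on the left is \<open>q (adj a * a)\<close> for a positive functional \<open>q\<close> with
  \<open>q 1 = (\<Sum>l<N. (cmod (c l))\<^sup>2)\<close>, so the general bound for positive functionals applies.\<close>

lemma column_combination_bound:
  fixes N :: nat
  shows "(norm (\<Sum>l<N. c l *\<^sub>C column a l))\<^sup>2 \<le> (norm a)\<^sup>2 * (\<Sum>l<N. (cmod (c l))\<^sup>2)"
proof -
  define q where "q x = (\<Sum>m<N. \<Sum>l<N. cnj (c m) * (c l * t x m l))" for x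
  have q: "ell2_inner (\<Sum>l<N. c l *\<^sub>C column x l) (\<Sum>l<N. c l *\<^sub>C column x l) = q (adj x * x)" for x
    unfolding q_def
    by (simp add: ell2.sum_left ell2.sum_right ell2.scale_left ell2.scale_right column_inner
        sum_distrib_left mult.assoc)
  interpret positive_functional q
  proof
    show "q (x + y) = q x + q y" for x y
      by (simp add: q_def entry_add distrib_left sum.distrib)
    show "q (d *\<^sub>C x) = d * q x" for d x
      by (simp add: q_def entry_scale sum_distrib_left mult_ac)
    show "q (adj x) = cnj (q x)" for x
      unfolding q_def by (subst sum.swap) (simp add: entry_adj mult_ac)
    show "0 \<le> Re (q (adj x * x))" for x
      unfolding q[symmetric] by (rule ell2.nonneg)
  qed
  have "q 1 = (\<Sum>l<N. of_real ((cmod (c l))\<^sup>2))"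
    by (simp add: q_def entry_one if_distrib mult.commute[of "cnj _"] complex_norm_square cong: if_cong
        del: of_real_power)
  then have "Re (q 1) = (\<Sum>l<N. (cmod (c l))\<^sup>2)" by simp
  with bound[of a 1] show ?thesis
    by (simp add: q[symmetric] ell2_inner_self)
qed

text \<open>Describing the coefficients by inner products with the columns of the adjoint element, rather
  than by sums over rows, makes sense before the matrix is known to be bounded.\<close>

definition matrix_op :: "'a \<Rightarrow> ell2 \<Rightarrow> ell2" where
  "matrix_op a x = Abs_ell2 (\<lambda>k. ell2_inner x (column (adj a) k))"

text \<open>Pairing \<open>x\<close> with the combination of columns whose coefficients are the numbers \<open>c k\<close> themselves
  gives \<open>S \<le> norm x * norm a * sqrt S\<close> for the partial sum \<open>S\<close>.\<close>

lemma matrix_op_partial_bound: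
  "(\<Sum>k<N. (cmod (ell2_inner x (column (adj a) k)))\<^sup>2) \<le> (norm a * norm x)\<^sup>2"
proof -
  define c where "c k = ell2_inner x (column (adj a) k)" for k
  define S where "S = (\<Sum>k<N. (cmod (c k))\<^sup>2)"
  define y where "y = (\<Sum>k<N. c k *\<^sub>C column (adj a) k)"
  have S0: "0 \<le> S" unfolding S_def by (intro sum_nonneg) simp
  have "ell2_inner x y = (\<Sum>k<N. cnj (c k) * c k)"
    by (simp add: y_def ell2.sum_right ell2.scale_right c_def)
  also have "\<dots> = of_real S"
    unfolding S_def of_real_sum complex_norm_square by (simp add: mult.commute)
  finally have "S \<le> norm x * norm y"
    using ell2.Cauchy_Schwarz[of x y] S0 by simp
  moreover have "(norm y)\<^sup>2 \<le> (norm a)\<^sup>2 * S"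
    using column_combination_bound[where c = c and a = "adj a" and N = N] by (simp add: y_def S_def)
  ultimately have "S\<^sup>2 \<le> (norm x)\<^sup>2 * ((norm a)\<^sup>2 * S)"
    using S0 by (smt (verit) mult_left_mono power_mono power_mult_distrib zero_le_power2)
  then have "S * S \<le> (norm a * norm x)\<^sup>2 * S" by (simp add: power2_eq_square mult_ac)
  then show ?thesis using S0 unfolding S_def[symmetric] c_def[symmetric]
    by (cases "S = 0") auto
qed

lemma matrix_op_nth [simp]: "ell2_nth (matrix_op a x) k = ell2_inner x (column (adj a) k)"
proof -
  have "summable (\<lambda>k. (cmod (ell2_inner x (column (adj a) k)))\<^sup>2)"
    by (rule summableI_nonneg_bounded[OF _ matrix_op_partial_bound]) simp
  then show ?thesis unfolding matrix_op_def by (subst Abs_ell2_inverse) auto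
qed

lemma matrix_op_bound: "norm (matrix_op a x) \<le> norm a * norm x"
proof -
  have "(\<Sum>k. (cmod (ell2_nth (matrix_op a x) k))\<^sup>2) \<le> (norm a * norm x)\<^sup>2"
    by (rule suminf_le_const[OF summable_ell2]) (simp add: matrix_op_partial_bound)
  then show ?thesis unfolding norm_ell2_def[of "matrix_op a x"]
    by (intro real_le_lsqrt) simp_all
qed

lemma matrix_op_add: "matrix_op a (x + y) = matrix_op a x + matrix_op a y"
  by (rule ell2_eqI) (simp add: plus_ell2.rep_eq ell2.add_left)

lemma matrix_op_scale: "matrix_op a (c *\<^sub>C x) = c *\<^sub>C matrix_op a x"
  by (rule ell2_eqI) (simp add: scaleC_ell2.rep_eq ell2.scale_left)

lemma matrix_op_unit_vec: "matrix_op a (unit_vec l) = column a l"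
  by (rule ell2_eqI) (simp add: ell2_inner_unit_vec_left entry_adj)

lemma matrix_op_adjoint: "ell2_inner (matrix_op (adj a) x) y = ell2_inner x (matrix_op a y)"
proof -
  have "ell2_inner (matrix_op (adj a) x) y - ell2_inner x (matrix_op a y) = 0"
  proof (rule functional_zero[of "\<lambda>x. ell2_inner (matrix_op (adj a) x) y - ell2_inner x (matrix_op a y)"
        "2 * norm a * norm y"])
    show "cmod (ell2_inner (matrix_op (adj a) x) y - ell2_inner x (matrix_op a y)) \<le> 2 * norm a * norm y * norm x" for x
    proof -
      have "cmod (ell2_inner (matrix_op (adj a) x) y) \<le> norm (matrix_op (adj a) x) * norm y"
        by (rule ell2.Cauchy_Schwarz)
      also have "\<dots> \<le> norm (adj a) * norm x * norm y" by (intro mult_right_mono matrix_op_bound) simp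
      finally have 1: "cmod (ell2_inner (matrix_op (adj a) x) y) \<le> norm a * norm y * norm x" by (simp add: mult_ac)
      have "cmod (ell2_inner x (matrix_op a y)) \<le> norm x * norm (matrix_op a y)"
        by (rule ell2.Cauchy_Schwarz)
      also have "\<dots> \<le> norm x * (norm a * norm y)" by (intro mult_left_mono matrix_op_bound) simp
      finally show ?thesis using 1
        norm_triangle_ineq4[of "ell2_inner (matrix_op (adj a) x) y" "ell2_inner x (matrix_op a y)"] by (simp add: mult_ac)
    qed
    show "ell2_inner (matrix_op (adj a) (unit_vec n)) y - ell2_inner (unit_vec n) (matrix_op a y) = 0" for n
      unfolding ell2_inner_unit_vec_left matrix_op_unit_vec matrix_op_nth by (metis ell2.herm right_minus_eq)
  qed (simp_all add: matrix_op_add matrix_op_scale ell2.add_left ell2.scale_left algebra_simps)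
  then show ?thesis by simp
qed

lemma matrix_op_column: "matrix_op a (column b k) = column (a * b) k"
  by (rule ell2_eqI) (simp add: column_inner adj_adj)

lemma matrix_op_mult: "matrix_op (a * b) x = matrix_op a (matrix_op b x)"
proof (rule ell2_eqI)
  fix k
  show "ell2_nth (matrix_op (a * b) x) k = ell2_nth (matrix_op a (matrix_op b x)) k"
    using matrix_op_adjoint[of "adj b" x "column (adj a) k"] by (simp add: matrix_op_column adj_mult adj_adj)
qed

lemma bounded_linear_matrix_op: "bounded_linear (matrix_op a)"
  by (rule bounded_linear_intro[where K = "norm a"])
    (simp_all add: matrix_op_add matrix_op_scale scaleR_scaleC matrix_op_bound mult.commute)

definition rep :: "'a \<Rightarrow> ell2 \<Rightarrow>\<^sub>L ell2" where
  "rep a = Blinfun (matrix_op a)"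

lemma rep_apply: "blinfun_apply (rep a) = matrix_op a"
  unfolding rep_def by (rule bounded_linear_Blinfun_apply[OF bounded_linear_matrix_op])

lemma rep_entry: "ell2_nth (blinfun_apply (rep a) (unit_vec l)) k = t a k l"
  by (simp only: rep_apply matrix_op_unit_vec column_nth)

lemma rep_in_Rep: "rep \<in> Rep"
  unfolding Rep_def bounded_ops_def is_adjoint_def
proof (intro CollectI conjI allI)
  show "rep (a + b) = rep a + rep b" for a b
    by (rule blinfun_eqI, rule ell2_eqI)
      (simp add: rep_apply plus_blinfun.rep_eq plus_ell2.rep_eq adj_add column_add ell2.add_right)
  show "blinfun_apply (rep (c *\<^sub>C a)) x = c *\<^sub>C blinfun_apply (rep a) x" for c a x
    by (rule ell2_eqI) (simp add: rep_apply scaleC_ell2.rep_eq adj_scaleC column_scale ell2.scale_right)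
  show "rep (a * b) = rep a o\<^sub>L rep b" for a b
    by (rule blinfun_eqI) (simp add: rep_apply matrix_op_mult)
  show "rep 1 = id_blinfun"
    by (rule blinfun_eqI, rule ell2_eqI) (simp add: rep_apply column_one ell2_inner_unit_vec)
qed (simp_all add: rep_apply matrix_op_scale matrix_op_adjoint)

end

section \<open>Representations separate points\<close>

text \<open>This is the construction of Gelfand, Naimark and Segal, carried out on matrix coefficients.
  A positive functional \<open>\<phi>\<close> with \<open>\<phi> (adj b * b) > 0\<close> makes the algebra a semi-inner product space in which
  a dense sequence is orthonormalised to a family \<open>e\<close>. The numbers \<open>\<phi> (adj (e m) * a * e n)\<close> are the
  coefficients of a representation on a space that may have finite dimension. To obtain one on the
  whole of \<open>\<ell>\<^sup>2\<close>, every basis vector is repeated infinitely often: the index set is \<open>D \<times> UNIV\<close>,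
  enumerated by \<open>\<beta>\<close>.\<close>

theorem Rep_separates_points:
  fixes b :: "'a::unital_cstar_algebra"
  assumes "separable_space (euclidean :: 'a topology)" "b \<noteq> 0"
  shows "\<exists>\<pi>\<in>Rep. \<pi> b \<noteq> 0"
proof -
  obtain \<phi> :: "'a \<Rightarrow> complex" where \<phi>: "positive_functional \<phi>" and b: "0 < Re (\<phi> (adj b * b))"
    using exists_positive_functional[OF assms(2)] .
  interpret positive_functional \<phi> by (rule \<phi>)
  define g where "g x y = \<phi> (adj y * x)" for x y
  interpret g: semi_inner g unfolding g_def by (rule semi_inner)
  have g_mult: "g (a * x) y = g x (adj a * y)" for a x y
    by (simp add: g_def adj_mult adj_adj mult.assoc)
  obtain U :: "'a set" where U: "countable U" "closure U = UNIV"
    using assms(1) by (auto simp: separable_space_def)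
  then have "U \<noteq> {}" by auto
  define d where "d = from_nat_into U"
  have "\<exists>n. g.seminorm (x - d n) < \<epsilon>" if "0 < \<epsilon>" for x \<epsilon>
  proof -
    define C where "C = sqrt (Re (\<phi> 1)) + 1"
    have \<phi>1: "0 \<le> Re (\<phi> 1)" using positive[of 1] by simp
    then have C: "C > 0" unfolding C_def by (smt (verit) real_sqrt_ge_zero)
    have seminorm_le: "g.seminorm y \<le> norm y * C" for y
    proof -
      have "(g.seminorm y)\<^sup>2 \<le> (norm y)\<^sup>2 * Re (\<phi> 1)" using bound[of y 1] by (simp add: g.seminorm_square g_def)
      also have "\<dots> = (norm y * sqrt (Re (\<phi> 1)))\<^sup>2" using \<phi>1 by (simp add: power_mult_distrib)
      finally have "g.seminorm y \<le> norm y * sqrt (Re (\<phi> 1))" by (rule power2_le_imp_le) (use \<phi>1 in simp)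
      then show ?thesis using norm_ge_zero[of y] unfolding C_def distrib_left by linarith
    qed
    have "0 < \<epsilon> / C" using that C by simp
    then obtain u where u: "u \<in> U" "dist u x < \<epsilon> / C"
      using U(2) closure_approachable[of x U] by blast
    then obtain n where "d n = u" unfolding d_def using from_nat_into_surj[OF U(1)] by blast
    then have "norm (x - d n) < \<epsilon> / C" using u(2) by (simp add: dist_norm norm_minus_commute)
    then have "norm (x - d n) * C < \<epsilon>" using C by (simp add: field_simps)
    then show ?thesis using seminorm_le[of "x - d n"] by (intro exI[of _ n]) linarith
  qed
  note parseval = g.parseval[OF this]
  define e where "e = g.gram_schmidt d"
  have e: "g (e m) (e n) = (if m = n \<and> e n \<noteq> 0 then 1 else 0)" for m n
    using g.orthonormal_gram_schmidt[of d] unfolding e_def g.orthonormal_def by blast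
  define D where "D = {n. e n \<noteq> 0}"
  have parseval: "((\<lambda>n. g x (e n) * g (e n) y) has_sum g x y) D" for x y
    unfolding D_def e_def by (rule parseval)
  have zero: "g x y = 0" if "\<And>n. n \<in> D \<Longrightarrow> g x (e n) * g (e n) y = 0" for x y
  proof -
    have "((\<lambda>n. 0) has_sum g x y) D" using parseval[of x y] that by (simp cong: has_sum_cong)
    from has_sum_unique[OF this has_sum_0] show ?thesis by simp
  qed
  have gb: "g b b \<noteq> 0" using b by (auto simp: g_def)
  have "D \<noteq> {}" using zero[of b b] gb by auto
  define \<beta> where "\<beta> = from_nat_into (D \<times> (UNIV :: nat set))"
  have \<beta>: "bij_betw \<beta> UNIV (D \<times> UNIV)"
    unfolding \<beta>_def using \<open>D \<noteq> {}\<close>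
    by (intro bij_betw_from_nat_into) (auto simp: finite_cartesian_product_iff)
  \<comment> \<open>second components label the copies of the space, which the matrices do not mix\<close>
  define t where "t a k l = (if snd (\<beta> k) = snd (\<beta> l) then g (a * e (fst (\<beta> l))) (e (fst (\<beta> k))) else 0)"
    for a k l
  have inj: "\<beta> k = \<beta> l \<longleftrightarrow> k = l" for k l using \<beta> by (auto simp: bij_betw_def inj_on_def)
  have fstD: "fst (\<beta> k) \<in> D" for k
    using bij_betwE[OF \<beta>] by (auto simp: mem_Times_iff)
  interpret star_matrix t
  proof
    show "t (x + y) k l = t x k l + t y k l" for x y k l
      by (simp add: t_def distrib_right g.add_left)
    show "t (c *\<^sub>C x) k l = c * t x k l" for c x k l
      by (simp add: t_def mult_scaleC_left g.scale_left)
    show "t (adj x) k l = cnj (t x l k)" for x k l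
      using g_mult[of "adj x"] g.herm[of "x * e (fst (\<beta> k))"] by (simp add: t_def adj_adj)
    show "t 1 k l = (if k = l then 1 else 0)" for k l
      using fstD[of k] inj[of k l] by (auto simp: t_def e D_def prod_eq_iff)
    show "(\<lambda>l. t x k l * t y l m) sums t (x * y) k m" for x y k m
    proof (cases "snd (\<beta> k) = snd (\<beta> m)")
      case True
      define j where "j = snd (\<beta> m)"
      let ?F = "\<lambda>n. g (y * e (fst (\<beta> m))) (e n) * g (e n) (adj x * e (fst (\<beta> k)))"
      have bij: "bij_betw (\<lambda>l. fst (\<beta> l)) {l. snd (\<beta> l) = j} D"
      proof (rule bij_betw_imageI)
        show "inj_on (\<lambda>l. fst (\<beta> l)) {l. snd (\<beta> l) = j}"
          by (rule inj_onI) (metis inj prod_eq_iff mem_Collect_eq)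
        have "n \<in> (\<lambda>l. fst (\<beta> l)) ` {l. snd (\<beta> l) = j}" if "n \<in> D" for n
        proof -
          have "(n, j) \<in> range \<beta>" using \<beta> that by (auto simp: bij_betw_def)
          then obtain l where "\<beta> l = (n, j)" by (metis imageE)
          then show ?thesis by (intro image_eqI[of _ _ l]) simp_all
        qed
        then show "(\<lambda>l. fst (\<beta> l)) ` {l. snd (\<beta> l) = j} = D" using fstD by blast
      qed
      have "((\<lambda>l. ?F (fst (\<beta> l))) has_sum g (y * e (fst (\<beta> m))) (adj x * e (fst (\<beta> k)))) {l. snd (\<beta> l) = j}"
        by (subst has_sum_reindex_bij_betw[OF bij, of ?F]) (rule parseval)
      also have "g (y * e (fst (\<beta> m))) (adj x * e (fst (\<beta> k))) = t (x * y) k m"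
        using True by (simp add: t_def g_mult adj_mult adj_adj mult.assoc)
      also have "((\<lambda>l. ?F (fst (\<beta> l))) has_sum t (x * y) k m) {l. snd (\<beta> l) = j} \<longleftrightarrow>
          ((\<lambda>l. t x k l * t y l m) has_sum t (x * y) k m) UNIV"
        by (rule has_sum_cong_neutral) (use True in \<open>auto simp: t_def j_def g_mult\<close>)
      finally show ?thesis by (rule has_sum_imp_sums)
    next
      case False
      then have "(\<lambda>l. t x k l * t y l m) = (\<lambda>l. 0)" "t (x * y) k m = 0"
        by (auto simp: t_def fun_eq_iff)
      then show ?thesis by simp
    qed
  qed
  have "rep b \<noteq> 0"
  proof
    assume "rep b = 0"
    then have t0: "t b k l = 0" for k l
      using rep_entry[of b l k] by (simp add: zero_ell2.rep_eq)
    have "g (b * e n) (e m) = 0" if "m \<in> D" "n \<in> D" for m n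
    proof -
      have "(m, 0) \<in> range \<beta>" "(n, 0) \<in> range \<beta>" using \<beta> that by (auto simp: bij_betw_def)
      then obtain k l where "\<beta> k = (m, 0)" "\<beta> l = (n, 0)" by (metis imageE)
      then show ?thesis using t0[of k l] by (simp add: t_def)
    qed
    then have "g 1 (adj b * e m) = 0" if "m \<in> D" for m
      using that by (intro zero) (simp add: g_mult)
    then have "g b (e m) = 0" if "m \<in> D" for m
      using that g_mult[of b 1 "e m"] by simp
    then have "g b b = 0" by (intro zero) simp
    with gb show False by simp
  qed
  then show ?thesis using rep_in_Rep by blast
qed

section \<open>Contractivity and unitary conjugation of representations\<close>

lemma Rep_add: "\<pi> \<in> Rep \<Longrightarrow> \<pi> (a + b) = \<pi> a + \<pi> b"
  by (simp add: Rep_def)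

lemma Rep_diff: "\<pi> \<in> Rep \<Longrightarrow> \<pi> (a - b) = \<pi> a - \<pi> b"
  using Rep_add[of \<pi> "a - b" b] by simp

lemma Rep_mult: "\<pi> \<in> Rep \<Longrightarrow> \<pi> (a * b) = \<pi> a o\<^sub>L \<pi> b"
  by (simp add: Rep_def)

lemma Rep_scaleC: "\<pi> \<in> Rep \<Longrightarrow> blinfun_apply (\<pi> (c *\<^sub>C a)) x = c *\<^sub>C blinfun_apply (\<pi> a) x"
  by (simp add: Rep_def)

lemma Rep_one: "\<pi> \<in> Rep \<Longrightarrow> \<pi> 1 = id_blinfun"
  by (simp add: Rep_def)

lemma Rep_adj: "\<pi> \<in> Rep \<Longrightarrow>
    ell2_inner (blinfun_apply (\<pi> (adj a)) x) y = ell2_inner x (blinfun_apply (\<pi> a) y)"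
  by (simp add: Rep_def is_adjoint_def)

lemma Rep_linear: "\<pi> \<in> Rep \<Longrightarrow> blinfun_apply (\<pi> a) (c *\<^sub>C x) = c *\<^sub>C blinfun_apply (\<pi> a) x"
  by (simp add: Rep_def bounded_ops_def)

text \<open>Vector states are positive functionals, so this is the estimate \<open>bound\<close> at the unit.\<close>

lemma Rep_norm_le:
  assumes "\<pi> \<in> Rep" shows "norm (\<pi> a) \<le> norm (a::'a::unital_cstar_algebra)"
proof (rule norm_blinfun_bound)
  fix x
  define \<phi> where "\<phi> y = ell2_inner (blinfun_apply (\<pi> y) x) x" for y
  have sq: "\<phi> (adj y * y) = of_real ((norm (blinfun_apply (\<pi> y) x))\<^sup>2)" for y
    using assms by (simp add: \<phi>_def Rep_mult Rep_adj ell2_inner_self)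
  interpret positive_functional \<phi>
  proof
    show "\<phi> (adj y) = cnj (\<phi> y)" for y
      using assms by (simp add: \<phi>_def Rep_adj) (metis ell2.herm)
    show "0 \<le> Re (\<phi> (adj y * y))" for y by (simp add: sq)
  qed (use assms in \<open>simp_all add: \<phi>_def Rep_add Rep_scaleC ell2.add_left ell2.scale_left plus_blinfun.rep_eq\<close>)
  have "(norm (blinfun_apply (\<pi> a) x))\<^sup>2 \<le> (norm a * norm x)\<^sup>2"
    using bound[of a 1] sq[of 1] assms by (simp add: sq Rep_one power_mult_distrib)
  then show "norm (blinfun_apply (\<pi> a) x) \<le> norm a * norm x"
    by (rule power2_le_imp_le) simp
qed simp

text \<open>For nonzero \<open>v\<close> this is a unitary that is its own inverse and adjoint, which keeps conjugation
  simple; the reflections alone already act irreducibly.\<close>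

definition reflection :: "ell2 \<Rightarrow> ell2 \<Rightarrow> ell2" where
  "reflection v x = x - (2 * ell2_inner x v / ell2_inner v v) *\<^sub>C v"

lemma reflection_involution: "v \<noteq> 0 \<Longrightarrow> reflection v (reflection v x) = x"
proof -
  assume "v \<noteq> 0"
  then have "ell2_inner v v \<noteq> 0" by (simp add: ell2_inner_self)
  then have "2 * ell2_inner (reflection v x) v / ell2_inner v v = - (2 * ell2_inner x v / ell2_inner v v)"
    by (simp add: reflection_def ell2.diff_left ell2.scale_left field_simps)
  then show ?thesis unfolding reflection_def[of v "reflection v x"]
    by (simp add: reflection_def)
qed

lemma reflection_self_adjoint: "ell2_inner (reflection v x) y = ell2_inner x (reflection v y)"
proof -
  have "cnj (ell2_inner v v) = ell2_inner v v" "cnj (ell2_inner y v) = ell2_inner v y"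
    by (metis ell2.herm)+
  then show ?thesis by (simp add: reflection_def ell2.diff_left ell2.diff_right ell2.scale_left ell2.scale_right)
qed

lemma reflection_add: "reflection v (x + y) = reflection v x + reflection v y"
  by (simp add: reflection_def ell2.add_left distrib_left add_divide_distrib scaleC_add_left)

lemma reflection_scale: "reflection v (c *\<^sub>C x) = c *\<^sub>C reflection v x"
  by (simp add: reflection_def ell2.scale_left scaleC_diff_right scaleC_scaleC mult.left_commute)

lemma norm_reflection: "v \<noteq> 0 \<Longrightarrow> norm (reflection v x) = norm x"
proof -
  assume v: "v \<noteq> 0"
  have "ell2_inner (reflection v x) (reflection v x) = ell2_inner x x"
    by (simp add: reflection_self_adjoint reflection_involution[OF v])
  then have "complex_of_real ((norm (reflection v x))\<^sup>2) = of_real ((norm x)\<^sup>2)"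
    by (simp only: ell2_inner_self)
  then have "(norm (reflection v x))\<^sup>2 = (norm x)\<^sup>2" by (simp only: of_real_eq_iff)
  then show ?thesis by (rule power2_eq_imp_eq) simp_all
qed

lemma bounded_linear_reflection: "v \<noteq> 0 \<Longrightarrow> bounded_linear (reflection v)"
  by (rule bounded_linear_intro[where K = 1])
    (simp_all add: reflection_add reflection_scale scaleR_scaleC norm_reflection)

lemma Rep_reflect:
  assumes \<pi>: "\<pi> \<in> Rep" and v: "v \<noteq> 0"
  defines "u \<equiv> Blinfun (reflection v)"
  shows "(\<lambda>a. u o\<^sub>L \<pi> a o\<^sub>L u) \<in> Rep"
proof -
  have u: "blinfun_apply u = reflection v"
    unfolding u_def by (rule bounded_linear_Blinfun_apply[OF bounded_linear_reflection[OF v]])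
  show ?thesis
    unfolding Rep_def bounded_ops_def is_adjoint_def
  proof (intro CollectI conjI allI)
    show "u o\<^sub>L \<pi> (a + b) o\<^sub>L u = (u o\<^sub>L \<pi> a o\<^sub>L u) + (u o\<^sub>L \<pi> b o\<^sub>L u)" for a b
      by (rule blinfun_eqI) (simp add: u Rep_add[OF \<pi>] plus_blinfun.rep_eq reflection_add)
    show "u o\<^sub>L \<pi> (a * b) o\<^sub>L u = (u o\<^sub>L \<pi> a o\<^sub>L u) o\<^sub>L (u o\<^sub>L \<pi> b o\<^sub>L u)" for a b
      by (rule blinfun_eqI) (simp add: u Rep_mult[OF \<pi>] reflection_involution[OF v])
    show "u o\<^sub>L \<pi> 1 o\<^sub>L u = id_blinfun"
      by (rule blinfun_eqI) (simp add: u Rep_one[OF \<pi>] reflection_involution[OF v])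
  qed (simp_all add: u reflection_scale Rep_linear[OF \<pi>] Rep_scaleC[OF \<pi>] Rep_adj[OF \<pi>] reflection_self_adjoint)
qed

lemma eigen_all_imp_scalar:
  assumes add: "\<And>x y. T (x + y) = T x + T y" and scale: "\<And>c x. T (c *\<^sub>C x) = c *\<^sub>C T x"
    and eigen: "\<And>v. v \<noteq> 0 \<Longrightarrow> \<exists>c. T v = c *\<^sub>C (v::ell2)"
  obtains c where "\<And>v. T v = c *\<^sub>C v"
proof -
  define w where "w = unit_vec 0"
  have w: "w \<noteq> 0" by (simp add: w_def unit_vec_nonzero)
  obtain c where c: "T w = c *\<^sub>C w" using eigen[OF w] by blast
  have "T v = c *\<^sub>C v" for v
  proof (cases "\<exists>d. v = d *\<^sub>C w")
    case True
    then show ?thesis using c scale by (auto simp: scaleC_scaleC mult.commute)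
  next
    case False
    have v: "v \<noteq> 0" using False scaleC_zero_left[of w] by metis
    obtain p where p: "T v = p *\<^sub>C v" using eigen[OF v] by blast
    have "v + w \<noteq> 0" using False by (metis scaleC_minus_left scaleC_one eq_neg_iff_add_eq_0)
    then obtain q where q: "T (v + w) = q *\<^sub>C (v + w)" using eigen by blast
    have eq: "(p - q) *\<^sub>C v = (q - c) *\<^sub>C w"
      using q p c add by (simp add: scaleC_add_right scaleC_diff_left algebra_simps)
    have "p = q"
    proof (rule ccontr)
      assume "p \<noteq> q"
      then have "v = (1 / (p - q)) *\<^sub>C (p - q) *\<^sub>C v" by (simp add: scaleC_scaleC)
      also have "\<dots> = ((q - c) / (p - q)) *\<^sub>C w" unfolding eq by (simp add: scaleC_scaleC)
      finally show False using False by blast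
    qed
    with eq have "(q - c) *\<^sub>C w = 0" by simp
    then have "q = c" using w by (metis norm_scaleC norm_eq_zero mult_eq_0_iff right_minus_eq)
    with p \<open>p = q\<close> show ?thesis by simp
  qed
  then show thesis by (rule that)
qed

text \<open>Conjugating a representation \<open>\<pi>\<close> by a reflection gives another one, so \<open>\<pi> a\<close> commutes with all
  reflections. Hence every vector is an eigenvector of \<open>\<pi> a\<close>, and \<open>\<pi> a\<close> is a scalar \<open>c\<close>. All
  representations then send \<open>a\<close> to \<open>c\<close>, and since they separate points, \<open>a = c 1\<close>.\<close>

theorem scalar_if_Rep_agree:
  fixes a :: "'a::unital_cstar_algebra"
  assumes "separable_space (euclidean :: 'a topology)"
    and agree: "\<And>\<pi> \<pi>'. \<pi> \<in> Rep \<Longrightarrow> \<pi>' \<in> Rep \<Longrightarrow> \<pi> a = \<pi>' a"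
  shows "\<exists>c. a = c *\<^sub>C 1"
proof (rule ccontr)
  assume *: "\<not> ?thesis"
  then have "a \<noteq> 0" using scaleC_zero_left[of "1::'a"] by metis
  then obtain \<pi> :: "'a \<Rightarrow> ell2 \<Rightarrow>\<^sub>L ell2" where \<pi>: "\<pi> \<in> Rep"
    using Rep_separates_points[OF assms(1)] by blast
  have "\<exists>c. blinfun_apply (\<pi> a) v = c *\<^sub>C v" if v: "v \<noteq> 0" for v
  proof -
    define u where "u = Blinfun (reflection v)"
    have u: "blinfun_apply u = reflection v"
      unfolding u_def by (rule bounded_linear_Blinfun_apply[OF bounded_linear_reflection[OF v]])
    have "\<pi> a = u o\<^sub>L \<pi> a o\<^sub>L u"
      using agree[OF \<pi> Rep_reflect[OF \<pi> v]] by (simp add: u_def)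
    then have "blinfun_apply (\<pi> a) v = reflection v (blinfun_apply (\<pi> a) (reflection v v))"
      by (metis blinfun_apply_blinfun_compose u)
    moreover have "reflection v v = (- 1) *\<^sub>C v"
    proof -
      have "reflection v v = v - 2 *\<^sub>C v" using v by (simp add: reflection_def ell2_inner_self)
      also have "\<dots> = (1 - 2) *\<^sub>C v" by (simp only: scaleC_diff_left scaleC_one)
      finally show ?thesis by simp
    qed
    ultimately have "blinfun_apply (\<pi> a) v = (- 1) *\<^sub>C reflection v (blinfun_apply (\<pi> a) v)"
      by (simp only: Rep_linear[OF \<pi>] reflection_scale)
    moreover define s where "s = 2 * ell2_inner (blinfun_apply (\<pi> a) v) v / ell2_inner v v"
    ultimately have "blinfun_apply (\<pi> a) v + blinfun_apply (\<pi> a) v = s *\<^sub>C v"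
      by (simp add: reflection_def s_def eq_diff_eq)
    moreover have "(1/2) *\<^sub>C (x + x) = x" for x :: ell2
      by (simp only: scaleC_add_right scaleC_add_left[symmetric]) simp
    ultimately have "blinfun_apply (\<pi> a) v = (1/2) *\<^sub>C s *\<^sub>C v" by metis
    then show ?thesis by (auto simp: scaleC_scaleC)
  qed
  then obtain c where c: "blinfun_apply (\<pi> a) v = c *\<^sub>C v" for v
    using eigen_all_imp_scalar[of "blinfun_apply (\<pi> a)"] by (metis blinfun.add_right Rep_linear[OF \<pi>])
  have "a - c *\<^sub>C 1 \<noteq> 0" using * by auto
  then obtain \<pi>' where \<pi>': "\<pi>' \<in> Rep" "\<pi>' (a - c *\<^sub>C 1) \<noteq> 0"
    using Rep_separates_points[OF assms(1)] by blast
  have "\<pi>' (a - c *\<^sub>C 1) = 0"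
    by (rule blinfun_eqI)
      (simp add: Rep_diff[OF \<pi>'(1)] Rep_scaleC[OF \<pi>'(1)] Rep_one[OF \<pi>'(1)] minus_blinfun.rep_eq
        agree[OF \<pi>'(1) \<pi>] c)
  with \<pi>'(2) show False by simp
qed

section \<open>Moduli of continuity\<close>

lemma Moduli_nonneg: "w \<in> Moduli \<Longrightarrow> 0 \<le> t \<Longrightarrow> 0 \<le> w t"
  by (simp add: Moduli_def)

lemma Moduli_zero: "(\<lambda>_. 0) \<in> Moduli"
  by (simp add: Moduli_def concave_on_const mono_on_def)

lemma Moduli_ident: "(\<lambda>t. t) \<in> Moduli"
  by (simp add: Moduli_def concave_on_ident mono_on_def)

lemma Moduli_combination:
  assumes "w \<in> Moduli" "v \<in> Moduli" "0 \<le> \<alpha>" "0 \<le> \<beta>"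
  shows "(\<lambda>t. \<alpha> * w t + \<beta> * v t) \<in> Moduli"
proof -
  have w: "continuous_on {0..} w" "concave_on {0..} w" "mono_on {0..} w" "w 0 = 0"
    and v: "continuous_on {0..} v" "concave_on {0..} v" "mono_on {0..} v" "v 0 = 0"
    using assms(1,2) by (simp_all add: Moduli_def)
  have "continuous_on {0..} (\<lambda>t. \<alpha> * w t + \<beta> * v t)" by (intro continuous_intros w v)
  moreover have "concave_on {0..} (\<lambda>t. \<alpha> * w t + \<beta> * v t)"
    by (intro concave_on_add concave_on_cmul w v assms)
  moreover have "mono_on {0..} (\<lambda>t. \<alpha> * w t + \<beta> * v t)"
    by (intro mono_onI add_mono mult_left_mono mono_onD[OF w(3)] mono_onD[OF v(3)] assms)
  moreover have "0 \<le> \<alpha> * w t + \<beta> * v t" if "0 \<le> t" for t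
    using assms Moduli_nonneg[OF _ that] by simp
  ultimately show ?thesis using w(4) v(4) by (simp add: Moduli_def)
qed

text \<open>An infimum of concave functions is concave, and concavity gives continuity in the interior of
  the half-line. At \<open>0\<close> the infimum is squeezed between \<open>0\<close> and \<open>w n + \<epsilon> n\<close> with \<open>\<epsilon> n\<close> small.\<close>

lemma Moduli_INF:
  fixes w :: "nat \<Rightarrow> real \<Rightarrow> real"
  assumes w: "\<And>n. w n \<in> Moduli" and \<epsilon>: "\<And>n. 0 \<le> \<epsilon> n" "\<epsilon> \<longlonglongrightarrow> 0"
  shows "(\<lambda>t. INF n. w n t + \<epsilon> n) \<in> Moduli"
proof -
  let ?W = "\<lambda>t. INF n. w n t + \<epsilon> n"
  have bdd: "bdd_below (range (\<lambda>n. w n t + \<epsilon> n))" if "0 \<le> t" for t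
    using Moduli_nonneg[OF w that] \<epsilon>(1) by (intro bdd_belowI2[of _ 0]) (simp add: add_nonneg_nonneg)
  have low: "?W t \<le> w n t + \<epsilon> n" if "0 \<le> t" for t n
    by (rule cINF_lower[OF bdd[OF that]]) simp
  have great: "c \<le> ?W t" if "\<And>n. c \<le> w n t + \<epsilon> n" for c t
    by (rule cINF_greatest) (use that in auto)
  have nonneg: "0 \<le> ?W t" if "0 \<le> t" for t
    by (rule great) (use Moduli_nonneg[OF w that] \<epsilon>(1) in \<open>simp add: add_nonneg_nonneg\<close>)
  have w0: "w n 0 = 0" for n using w by (simp add: Moduli_def)
  have "?W 0 \<le> 0"
    by (rule LIMSEQ_le_const[OF \<epsilon>(2)]) (use low[of 0] w0 in auto)
  then have W0: "?W 0 = 0" using nonneg[of 0] by simp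
  have conc: "concave_on {0..} ?W"
    unfolding concave_on_iff
  proof (intro conjI ballI allI impI)
    fix x y u v :: real
    assume *: "x \<in> {0..}" "y \<in> {0..}" "0 \<le> u" "0 \<le> v" "u + v = 1"
    show "u * ?W x + v * ?W y \<le> ?W (u *\<^sub>R x + v *\<^sub>R y)"
    proof (rule great)
      fix n
      have "concave_on {0..} (w n)" using w by (simp add: Moduli_def)
      then have "u * w n x + v * w n y \<le> w n (u *\<^sub>R x + v *\<^sub>R y)"
        using * unfolding concave_on_iff by blast
      moreover have "u * ?W x \<le> u * (w n x + \<epsilon> n)" "v * ?W y \<le> v * (w n y + \<epsilon> n)"
        using * low by (auto intro!: mult_left_mono)
      moreover have "u * \<epsilon> n + v * \<epsilon> n = \<epsilon> n" using * by (simp flip: distrib_right)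
      ultimately show "u * ?W x + v * ?W y \<le> w n (u *\<^sub>R x + v *\<^sub>R y) + \<epsilon> n"
        by (simp add: distrib_left)
    qed
  qed simp
  have mono: "mono_on {0..} ?W"
  proof (rule mono_onI)
    fix s t :: real assume *: "s \<in> {0..}" "t \<in> {0..}" "s \<le> t"
    show "?W s \<le> ?W t"
    proof (rule great)
      fix n
      have "mono_on {0..} (w n)" using w[of n] by (simp add: Moduli_def)
      then have "w n s \<le> w n t" using * by (rule mono_onD)
      then show "?W s \<le> w n t + \<epsilon> n" using low[of s n] * by simp
    qed
  qed
  have "continuous_on {0..} ?W"
    unfolding continuous_on_def
  proof
    fix x :: real assume x: "x \<in> {0..}"
    show "(?W \<longlongrightarrow> ?W x) (at x within {0..})"
    proof (cases "x = 0")
      case False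
      have "convex_on {0<..} (\<lambda>t. - ?W t)"
        using conc unfolding concave_on_def by (rule convex_on_subset) auto
      then have "continuous_on {0<..} (\<lambda>t. - ?W t)" by (intro convex_on_continuous) auto
      then have "continuous_on {0<..} (\<lambda>t. - (- ?W t))" by (rule continuous_on_minus)
      then have "isCont ?W x" using False x by (simp add: continuous_on_eq_continuous_at)
      then have "continuous (at x within {0..}) ?W" by (rule continuous_at_imp_continuous_at_within)
      then show ?thesis by (simp add: continuous_within)
    next
      case True
      have "(?W \<longlongrightarrow> 0) (at 0 within {0..})"
      proof (rule tendstoI)
        fix e :: real assume "0 < e"
        then obtain n where n: "\<epsilon> n < e / 2"
          using order_tendstoD(2)[OF \<epsilon>(2), of "e / 2"] by (auto simp: eventually_sequentially)
        have "continuous_on {0..} (w n)" using w[of n] by (simp add: Moduli_def)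
        then have "(w n \<longlongrightarrow> w n 0) (at 0 within {0..})"
          unfolding continuous_on_def by (rule bspec) simp
        then have "(w n \<longlongrightarrow> 0) (at 0 within {0..})" by (simp only: w0)
        then have "\<forall>\<^sub>F t in at 0 within {0..}. w n t < e / 2"
          by (rule order_tendstoD) (use \<open>0 < e\<close> in simp)
        moreover have "\<forall>\<^sub>F t in at 0 within {0..}. t \<in> {0::real..}"
          by (simp add: eventually_at_filter)
        ultimately show "\<forall>\<^sub>F t in at 0 within {0..}. dist (?W t) 0 < e"
        proof eventually_elim
          fix t :: real assume "w n t < e / 2" "t \<in> {0..}"
          then show "dist (?W t) 0 < e" using low[of t n] nonneg[of t] n by (simp add: dist_real_def)
        qed
      qed
      with True show ?thesis by (simp add: W0)
    qed
  qed
  with conc mono nonneg W0 show ?thesis unfolding Moduli_def by blast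
qed

definition majorants :: "'a::unital_cstar_algebra set \<Rightarrow> 'a \<Rightarrow> (real \<Rightarrow> real) set" where
  "majorants K a = {w \<in> Moduli. \<forall>s\<ge>0. osc K a s \<le> w s}"

lemma Rep_diff_norm_le: "\<pi> \<in> Rep \<Longrightarrow> \<pi>' \<in> Rep \<Longrightarrow> norm (\<pi> a - \<pi>' a) \<le> 2 * norm a"
  using norm_triangle_ineq4[of "\<pi> a" "\<pi>' a"] Rep_norm_le[of \<pi> a] Rep_norm_le[of \<pi>' a] by linarith

lemma osc_le:
  assumes "\<And>\<pi> \<pi>'. \<pi> \<in> Rep \<Longrightarrow> \<pi>' \<in> Rep \<Longrightarrow> rep_dist K \<pi> \<pi>' \<le> t \<Longrightarrow> norm (\<pi> a - \<pi>' a) \<le> c" "0 \<le> c"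
  shows "osc K a t \<le> c"
  unfolding osc_def by (rule cSup_least) (use assms in auto)

lemma osc_bdd_above:
  "bdd_above (insert 0 {norm (\<pi> a - \<pi>' a) | \<pi> \<pi>'. \<pi> \<in> Rep \<and> \<pi>' \<in> Rep \<and> rep_dist K \<pi> \<pi>' \<le> t})"
  unfolding bdd_above_insert by (rule bdd_aboveI[of _ "2 * norm a"]) (use Rep_diff_norm_le in blast)

lemma osc_ge:
  "\<pi> \<in> Rep \<Longrightarrow> \<pi>' \<in> Rep \<Longrightarrow> rep_dist K \<pi> \<pi>' \<le> t \<Longrightarrow> norm (\<pi> a - \<pi>' a) \<le> osc K a t"
  unfolding osc_def by (rule cSup_upper[OF _ osc_bdd_above]) blast

lemma osc_nonneg: "0 \<le> osc K a t"
  unfolding osc_def by (rule cSup_upper[OF _ osc_bdd_above]) blast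

lemma osc_combination:
  assumes "0 \<le> \<alpha>" "0 \<le> \<beta>"
    and "\<And>\<pi> \<pi>'. \<pi> \<in> Rep \<Longrightarrow> \<pi>' \<in> Rep \<Longrightarrow>
      norm (\<pi> c - \<pi>' c) \<le> \<alpha> * norm (\<pi> a - \<pi>' a) + \<beta> * norm (\<pi> b - \<pi>' b)"
  shows "osc K c t \<le> \<alpha> * osc K a t + \<beta> * osc K b t"
proof (rule osc_le)
  fix \<pi> \<pi>' assume *: "\<pi> \<in> Rep" "\<pi>' \<in> Rep" "rep_dist K \<pi> \<pi>' \<le> t"
  have "norm (\<pi> c - \<pi>' c) \<le> \<alpha> * norm (\<pi> a - \<pi>' a) + \<beta> * norm (\<pi> b - \<pi>' b)"
    using assms(3) * by blast
  also have "\<dots> \<le> \<alpha> * osc K a t + \<beta> * osc K b t"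
    using assms(1,2) osc_ge[OF *] by (intro add_mono mult_left_mono)
  finally show "norm (\<pi> c - \<pi>' c) \<le> \<alpha> * osc K a t + \<beta> * osc K b t" .
qed (use assms(1,2) osc_nonneg in \<open>intro add_nonneg_nonneg mult_nonneg_nonneg\<close>)

lemma majorants_combination:
  assumes "0 \<le> \<alpha>" "0 \<le> \<beta>"
    and "\<And>\<pi> \<pi>'. \<pi> \<in> Rep \<Longrightarrow> \<pi>' \<in> Rep \<Longrightarrow>
      norm (\<pi> c - \<pi>' c) \<le> \<alpha> * norm (\<pi> a - \<pi>' a) + \<beta> * norm (\<pi> b - \<pi>' b)"
    and w: "w \<in> majorants K a" "v \<in> majorants K b"
  shows "(\<lambda>t. \<alpha> * w t + \<beta> * v t) \<in> majorants K c"
proof -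
  have "osc K c s \<le> \<alpha> * w s + \<beta> * v s" if "0 \<le> s" for s
  proof -
    have "osc K c s \<le> \<alpha> * osc K a s + \<beta> * osc K b s" by (rule osc_combination[OF assms(1-3)])
    also have "\<dots> \<le> \<alpha> * w s + \<beta> * v s"
      using assms(1,2) w that by (intro add_mono mult_left_mono) (auto simp: majorants_def)
    finally show ?thesis .
  qed
  then show ?thesis using w Moduli_combination assms(1,2) by (auto simp: majorants_def)
qed

lemma Rep_diff_norm_mult:
  assumes "\<pi> \<in> Rep" "\<pi>' \<in> Rep"
  shows "norm (\<pi> (a * b) - \<pi>' (a * b)) \<le> norm a * norm (\<pi> b - \<pi>' b) + norm b * norm (\<pi> a - \<pi>' a)"
proof -
  have "\<pi> (a * b) - \<pi>' (a * b) = (\<pi> a o\<^sub>L (\<pi> b - \<pi>' b)) + ((\<pi> a - \<pi>' a) o\<^sub>L \<pi>' b)"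
    by (rule blinfun_eqI)
      (simp add: Rep_mult assms minus_blinfun.rep_eq plus_blinfun.rep_eq blinfun.diff_right)
  also have "norm \<dots> \<le> norm (\<pi> a) * norm (\<pi> b - \<pi>' b) + norm (\<pi> a - \<pi>' a) * norm (\<pi>' b)"
    by (intro norm_triangle_le add_mono norm_blinfun_compose)
  also have "\<dots> \<le> norm a * norm (\<pi> b - \<pi>' b) + norm (\<pi> a - \<pi>' a) * norm b"
    by (intro add_mono mult_mono Rep_norm_le assms order_refl norm_ge_zero)
  finally show ?thesis by (simp add: mult.commute)
qed

lemma Rep_diff_norm_add:
  assumes "\<pi> \<in> Rep" "\<pi>' \<in> Rep"
  shows "norm (\<pi> (a + b) - \<pi>' (a + b)) \<le> norm (\<pi> a - \<pi>' a) + norm (\<pi> b - \<pi>' b)"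
  using norm_triangle_ineq[of "\<pi> a - \<pi>' a" "\<pi> b - \<pi>' b"] by (simp add: Rep_add assms algebra_simps)

lemma Rep_diff_norm_scaleC:
  assumes "\<pi> \<in> Rep" "\<pi>' \<in> Rep"
  shows "norm (\<pi> (z *\<^sub>C a) - \<pi>' (z *\<^sub>C a)) \<le> cmod z * norm (\<pi> a - \<pi>' a)"
proof (rule norm_blinfun_bound)
  fix x
  have "blinfun_apply (\<pi> (z *\<^sub>C a) - \<pi>' (z *\<^sub>C a)) x = z *\<^sub>C blinfun_apply (\<pi> a - \<pi>' a) x"
    by (simp add: minus_blinfun.rep_eq Rep_scaleC assms scaleC_diff_right)
  then show "norm (blinfun_apply (\<pi> (z *\<^sub>C a) - \<pi>' (z *\<^sub>C a)) x) \<le> cmod z * norm (\<pi> a - \<pi>' a) * norm x"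
    by (simp add: norm_scaleC mult.assoc mult_left_mono norm_blinfun)
qed simp

lemma Rep_diff_scalar:
  assumes "\<pi> \<in> Rep" "\<pi>' \<in> Rep" shows "\<pi> (z *\<^sub>C (1::'a::unital_cstar_algebra)) - \<pi>' (z *\<^sub>C (1::'a)) = 0"
  using Rep_diff_norm_scaleC[OF assms, of z 1] by (simp add: Rep_one assms)

lemma norm_adjoint_le:
  assumes "\<And>x y. ell2_inner (blinfun_apply S x) y = ell2_inner x (blinfun_apply T y)"
  shows "norm S \<le> norm T"
proof (rule norm_blinfun_bound)
  fix x
  let ?y = "blinfun_apply S x"
  have "(norm ?y)\<^sup>2 = cmod (ell2_inner ?y ?y)" by (simp add: ell2_inner_self norm_power)
  also have "\<dots> = cmod (ell2_inner x (blinfun_apply T ?y))" by (simp only: assms)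
  also have "\<dots> \<le> norm x * norm (blinfun_apply T ?y)" by (rule ell2.Cauchy_Schwarz)
  also have "\<dots> \<le> norm x * (norm T * norm ?y)" by (intro mult_left_mono norm_blinfun) simp
  finally have "norm ?y * norm ?y \<le> norm T * norm x * norm ?y" by (simp add: power2_eq_square mult_ac)
  then show "norm ?y \<le> norm T * norm x" by (cases "?y = 0") auto
qed simp

lemma Rep_diff_norm_adj:
  assumes "\<pi> \<in> Rep" "\<pi>' \<in> Rep"
  shows "norm (\<pi> (adj a) - \<pi>' (adj a)) \<le> norm (\<pi> a - \<pi>' a)"
  by (rule norm_adjoint_le)
    (simp add: minus_blinfun.rep_eq ell2.diff_left ell2.diff_right Rep_adj assms)

text \<open>The elements with a majorant form a C*-subalgebra: the estimates for sums, products, adjoints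
  and multiples transfer to majorants, and a limit of such elements inherits the infimum of their
  majorants, shifted by the approximation errors. It contains \<open>K\<close>, where the identity function is a
  majorant; compactness of \<open>K\<close> enters in that the supremum defining \<open>rep_dist\<close> is finite.\<close>

theorem majorants_nonempty:
  fixes K :: "'a::unital_cstar_algebra set"
  assumes "compact K" "generates K"
  shows "majorants K a \<noteq> {}"
proof -
  define B where "B = {a. majorants K a \<noteq> {}}"
  have K: "x \<in> B" if x: "x \<in> K" for x
  proof -
    obtain M where M: "\<And>x. x \<in> K \<Longrightarrow> norm x \<le> M"
      using compact_imp_bounded[OF assms(1)] by (auto simp: bounded_iff)
    have "osc K x s \<le> s" if "0 \<le> s" for s
    proof (rule osc_le[OF _ that])
      fix \<pi> \<pi>' :: "'a \<Rightarrow> ell2 \<Rightarrow>\<^sub>L ell2" assume *: "\<pi> \<in> Rep" "\<pi>' \<in> Rep" "rep_dist K \<pi> \<pi>' \<le> s"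
      have "norm (\<pi> y - \<pi>' y) \<le> 2 * M" if "y \<in> K" for y
        using Rep_diff_norm_le[OF *(1,2), of y] M[OF that] by simp
      then have "bdd_above (insert 0 {norm (\<pi> y - \<pi>' y) | y. y \<in> K})"
        unfolding bdd_above_insert by (intro bdd_aboveI[of _ "2 * M"]) auto
      then have "norm (\<pi> x - \<pi>' x) \<le> rep_dist K \<pi> \<pi>'"
        unfolding rep_dist_def using x by (intro cSup_upper) auto
      with *(3) show "norm (\<pi> x - \<pi>' x) \<le> s" by simp
    qed
    then show ?thesis using Moduli_ident unfolding B_def majorants_def by blast
  qed
  have scalar: "z *\<^sub>C 1 \<in> B" for z
  proof -
    have "osc K (z *\<^sub>C 1 :: 'a) s \<le> 0" for s by (rule osc_le) (simp_all add: Rep_diff_scalar)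
    then show ?thesis using Moduli_zero unfolding B_def majorants_def by blast
  qed
  have comb: "c \<in> B" if xy: "x \<in> B" "y \<in> B" and bound: "0 \<le> \<alpha>" "0 \<le> \<beta>"
    "\<And>\<pi> \<pi>'. \<pi> \<in> Rep \<Longrightarrow> \<pi>' \<in> Rep \<Longrightarrow> norm (\<pi> c - \<pi>' c) \<le> \<alpha> * norm (\<pi> x - \<pi>' x) + \<beta> * norm (\<pi> y - \<pi>' y)"
    for c x y \<alpha> \<beta>
  proof -
    obtain w v where "w \<in> majorants K x" "v \<in> majorants K y" using xy by (auto simp: B_def)
    then have "(\<lambda>t. \<alpha> * w t + \<beta> * v t) \<in> majorants K c"
      by (intro majorants_combination[where a = x and b = y] bound)
    then show ?thesis unfolding B_def by blast
  qed
  have "closed B"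
    unfolding closed_sequential_limits
  proof (intro allI impI, elim conjE)
    fix x l assume x: "\<forall>n. x n \<in> B" and lim: "x \<longlonglongrightarrow> l"
    then have "\<forall>n. \<exists>w. w \<in> majorants K (x n)" by (auto simp: B_def)
    then obtain w where w: "\<And>n. w n \<in> majorants K (x n)" by metis
    define \<epsilon> where "\<epsilon> n = 2 * norm (l - x n)" for n
    have "(\<lambda>n. 2 * norm (l - x n)) \<longlonglongrightarrow> 2 * norm (l - l)" by (intro tendsto_intros lim)
    then have \<epsilon>: "\<epsilon> \<longlonglongrightarrow> 0" "\<And>n. 0 \<le> \<epsilon> n" by (simp_all add: \<epsilon>_def [abs_def])
    have "osc K l s \<le> (INF n. w n s + \<epsilon> n)" if s: "0 \<le> s" for s
    proof (rule cINF_greatest)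
      fix n
      have wn: "osc K (x n) s \<le> w n s" using w[of n] s by (simp add: majorants_def)
      show "osc K l s \<le> w n s + \<epsilon> n"
      proof (rule osc_le)
        show "0 \<le> w n s + \<epsilon> n" using wn osc_nonneg[of K "x n" s] \<epsilon>(2)[of n] by linarith
        fix \<pi> \<pi>' :: "'a \<Rightarrow> ell2 \<Rightarrow>\<^sub>L ell2" assume *: "\<pi> \<in> Rep" "\<pi>' \<in> Rep" "rep_dist K \<pi> \<pi>' \<le> s"
        show "norm (\<pi> l - \<pi>' l) \<le> w n s + \<epsilon> n"
          using Rep_diff_norm_add[OF *(1,2), of "x n" "l - x n"] Rep_diff_norm_le[OF *(1,2), of "l - x n"]
            osc_ge[OF *, of "x n"] wn by (simp add: \<epsilon>_def)
      qed
    qed simp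
    moreover have "(\<lambda>t. INF n. w n t + \<epsilon> n) \<in> Moduli"
      using w \<epsilon> by (intro Moduli_INF) (auto simp: majorants_def)
    ultimately show "l \<in> B" unfolding B_def majorants_def by blast
  qed
  moreover have "0 \<in> B" using scalar[of 0] by simp
  moreover have "x + y \<in> B" if "x \<in> B" "y \<in> B" for x y
    by (rule comb[OF that, of 1 1]) (simp_all add: Rep_diff_norm_add)
  moreover have "x * y \<in> B" if "x \<in> B" "y \<in> B" for x y
    by (rule comb[OF that(2,1), of "norm x" "norm y"]) (simp_all add: Rep_diff_norm_mult)
  moreover have "adj x \<in> B" if "x \<in> B" for x
    by (rule comb[OF that that, of 1 0]) (simp_all add: Rep_diff_norm_adj)
  moreover have "c *\<^sub>C x \<in> B" if "x \<in> B" for c x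
    by (rule comb[OF that that, of "cmod c" 0]) (simp_all add: Rep_diff_norm_scaleC)
  ultimately have "cstar_subalgebra B" by (simp add: cstar_subalgebra_def)
  moreover have "K \<union> {1} \<subseteq> B" using K scalar[of 1] by auto
  ultimately have "cstar_generated (K \<union> {1}) \<subseteq> B" unfolding cstar_generated_def by blast
  then show ?thesis using assms(2) unfolding generates_def B_def by blast
qed

lemma modulus_majorants: "modulus K a t = (INF w\<in>majorants K a. w t)"
  unfolding modulus_def majorants_def by (rule arg_cong[where f = Inf]) auto

lemma modulus_le: "w \<in> majorants K a \<Longrightarrow> 0 \<le> t \<Longrightarrow> modulus K a t \<le> w t"
  unfolding modulus_majorants
  by (rule cINF_lower[OF bdd_belowI2[of _ 0]]) (simp_all add: majorants_def Moduli_nonneg)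

lemma le_modulus:
  "majorants K a \<noteq> {} \<Longrightarrow> (\<And>w. w \<in> majorants K a \<Longrightarrow> c \<le> w t) \<Longrightarrow> c \<le> modulus K a t"
  unfolding modulus_majorants by (rule cINF_greatest)

text \<open>All the inequalities for the modulus come from this principle: a linear estimate between the
  variations over each pair of representations passes to the oscillations, to their majorants and
  to the infimum.\<close>

lemma modulus_combination:
  assumes K: "compact K" "generates K" and nn: "0 \<le> \<alpha>" "0 \<le> \<beta>" and t: "0 \<le> t"
    and norm: "\<And>\<pi> \<pi>'. \<pi> \<in> Rep \<Longrightarrow> \<pi>' \<in> Rep \<Longrightarrow>
      norm (\<pi> c - \<pi>' c) \<le> \<alpha> * norm (\<pi> a - \<pi>' a) + \<beta> * norm (\<pi> b - \<pi>' b)"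
  shows "modulus K c t \<le> \<alpha> * modulus K a t + \<beta> * modulus K b t"
proof (rule field_le_epsilon)
  fix e :: real assume e: "0 < e"
  have near: "\<exists>w\<in>majorants K x. r * w t \<le> r * modulus K x t + e / 2" if r: "0 \<le> r" for x r
  proof -
    have "modulus K x t < modulus K x t + e / (2 * (r + 1))" using e r by simp
    then have "\<exists>w\<in>majorants K x. w t < modulus K x t + e / (2 * (r + 1))"
      using le_modulus[OF majorants_nonempty[OF K], where a = x and t = t and c = "modulus K x t + e / (2 * (r + 1))"]
      by (meson not_less)
    then obtain w where w: "w \<in> majorants K x" "w t \<le> modulus K x t + e / (2 * (r + 1))" by force
    have "r * w t \<le> r * modulus K x t + r * (e / (2 * (r + 1)))"
      using mult_left_mono[OF w(2) r] by (simp add: distrib_left)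
    also have "r * (e / (2 * (r + 1))) \<le> e / 2" using e r by (simp add: field_simps)
    finally show ?thesis using w(1) by auto
  qed
  obtain w v where "w \<in> majorants K a" "\<alpha> * w t \<le> \<alpha> * modulus K a t + e / 2"
    "v \<in> majorants K b" "\<beta> * v t \<le> \<beta> * modulus K b t + e / 2" using near nn by meson
  then show "modulus K c t \<le> \<alpha> * modulus K a t + \<beta> * modulus K b t + e"
    using modulus_le[OF majorants_combination[where a = a and b = b, OF nn norm] t] by fastforce
qed

lemma modulus_dominated:
  assumes "compact K" "generates K" "0 \<le> \<alpha>" "0 \<le> t"
    and "\<And>\<pi> \<pi>'. \<pi> \<in> Rep \<Longrightarrow> \<pi>' \<in> Rep \<Longrightarrow> norm (\<pi> c - \<pi>' c) \<le> \<alpha> * norm (\<pi> a - \<pi>' a)"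
  shows "modulus K c t \<le> \<alpha> * modulus K a t"
  using modulus_combination[OF assms(1-3) order_refl assms(4), of c a a] assms(5) by simp

lemma modulus_eq_zero_iff:
  fixes K :: "'a::unital_cstar_algebra set"
  assumes "separable_space (euclidean :: 'a topology)" "compact K" "generates K"
  shows "(\<forall>t\<ge>0. modulus K a t = 0) \<longleftrightarrow> (\<exists>c. a = c *\<^sub>C 1)"
proof
  assume zero: "\<forall>t\<ge>0. modulus K a t = 0"
  show "\<exists>c. a = c *\<^sub>C 1"
  proof (rule scalar_if_Rep_agree[OF assms(1)])
    fix \<pi> \<pi>' :: "'a \<Rightarrow> ell2 \<Rightarrow>\<^sub>L ell2" assume *: "\<pi> \<in> Rep" "\<pi>' \<in> Rep"
    define t where "t = max 0 (rep_dist K \<pi> \<pi>')"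
    have t: "0 \<le> t" "rep_dist K \<pi> \<pi>' \<le> t" by (simp_all add: t_def)
    have "norm (\<pi> a - \<pi>' a) \<le> osc K a t" by (rule osc_ge[OF * t(2)])
    also have "\<dots> \<le> modulus K a t"
      by (rule le_modulus[OF majorants_nonempty[OF assms(2,3)]]) (use t(1) in \<open>auto simp: majorants_def\<close>)
    also have "\<dots> = 0" using zero t(1) by blast
    finally have "norm (\<pi> a - \<pi>' a) \<le> 0" .
    then show "\<pi> a = \<pi>' a" by simp
  qed
next
  assume "\<exists>c. a = c *\<^sub>C 1"
  then obtain c where c: "a = c *\<^sub>C 1" ..
  have agree: "\<pi> a - \<pi>' a = 0" if "\<pi> \<in> Rep" "\<pi>' \<in> Rep" for \<pi> \<pi>'
    unfolding c by (rule Rep_diff_scalar[OF that])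
  have "osc K a s \<le> 0" for s by (rule osc_le) (simp_all add: agree)
  then have "(\<lambda>_. 0) \<in> majorants K a" using Moduli_zero by (simp add: majorants_def)
  show "\<forall>t\<ge>0. modulus K a t = 0"
  proof (intro allI impI antisym)
    fix t :: real assume t: "0 \<le> t"
    show "modulus K a t \<le> 0" using modulus_le[OF \<open>(\<lambda>_. 0) \<in> majorants K a\<close> t] .
    show "0 \<le> modulus K a t"
      by (rule le_modulus[OF majorants_nonempty[OF assms(2,3)]])
        (use t in \<open>simp add: majorants_def Moduli_nonneg\<close>)
  qed
qed

theorem mainTheorem4:
  fixes K :: "'a::unital_cstar_algebra set" and a b :: 'a and z :: complex
  assumes "separable_space (euclidean :: 'a topology)"
    and "compact K"
    and "generates K"
  shows "(\<forall>t\<ge>0. modulus K (a + z *\<^sub>C 1) t = modulus K a t \<and> modulus K a t = modulus K (adj a) t) \<and>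
    ((\<forall>t\<ge>0. modulus K a t = 0) \<longleftrightarrow> (\<exists>c. a = c *\<^sub>C 1)) \<and>
    (\<forall>t\<ge>0. modulus K (z *\<^sub>C a) t = cmod z * modulus K a t) \<and>
    (\<forall>t\<ge>0. modulus K (a + b) t \<le> modulus K a t + modulus K b t) \<and>
    (\<forall>t\<ge>0. modulus K (a * b) t \<le> norm a * modulus K b t + norm b * modulus K a t)"
proof -
  note dominated = modulus_dominated[OF assms(2,3)]
  have shift: "norm (\<pi> (a + z *\<^sub>C 1) - \<pi>' (a + z *\<^sub>C 1)) = norm (\<pi> a - \<pi>' a)"
    if "\<pi> \<in> Rep" "\<pi>' \<in> Rep" for \<pi> \<pi>'
    using Rep_diff_scalar[OF that, of z] that by (simp add: Rep_add)
  have "modulus K (a + z *\<^sub>C 1) t = modulus K a t" if "0 \<le> t" for t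
    using dominated[of 1 t "a + z *\<^sub>C 1" a] dominated[of 1 t a "a + z *\<^sub>C 1"] that shift by simp
  moreover have "modulus K a t = modulus K (adj a) t" if "0 \<le> t" for t
    using dominated[of 1 t a "adj a"] dominated[of 1 t "adj a" a] that
      Rep_diff_norm_adj[of _ _ a] Rep_diff_norm_adj[of _ _ "adj a"] by (simp add: adj_adj)
  moreover have "modulus K (z *\<^sub>C a) t = cmod z * modulus K a t" if t: "0 \<le> t" for t
  proof (rule antisym)
    have le: "modulus K (c *\<^sub>C x) t \<le> cmod c * modulus K x t" for c x
      by (rule dominated) (simp_all add: t Rep_diff_norm_scaleC)
    show "modulus K (z *\<^sub>C a) t \<le> cmod z * modulus K a t" by (rule le)
    show "cmod z * modulus K a t \<le> modulus K (z *\<^sub>C a) t"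
    proof (cases "z = 0")
      case True
      then have "\<forall>t\<ge>0. modulus K (z *\<^sub>C a) t = 0"
        unfolding modulus_eq_zero_iff[OF assms] by (intro exI[of _ 0]) simp
      with True t show ?thesis by simp
    next
      case False
      then show ?thesis using le[of "1 / z" "z *\<^sub>C a"]
        by (simp add: scaleC_scaleC norm_divide field_simps)
    qed
  qed
  moreover have "modulus K (a + b) t \<le> modulus K a t + modulus K b t" if "0 \<le> t" for t
    using modulus_combination[OF assms(2,3), of 1 1 t "a + b" a b] that by (simp add: Rep_diff_norm_add)
  moreover have "modulus K (a * b) t \<le> norm a * modulus K b t + norm b * modulus K a t" if "0 \<le> t" for t
    using modulus_combination[OF assms(2,3), of "norm a" "norm b" t "a * b" b a] that
    by (simp add: Rep_diff_norm_mult)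
  ultimately show ?thesis using modulus_eq_zero_iff[OF assms, of a] by blast
qed

end
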